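(* (i) Semi-Acyclic 2TRG Winning Set of order $n\times n$ can be verified via boolean matrix product verification of size $n\times n\times n$, with only $O(n^2)$ extra time. (ii) Acyclic Simulation of order $n$ and Semi-Acyclic 2TRG Winning Set of order $n\times n$ admit a certificate of size $O(n^2)$ that can be verified via standard $(+,\times)$-matrix product verification of size $n\times n\times n$.
   Context: A game-graph is $\mathcal G=(\mathcal V,\mathcal E,\mathcal V^0,\mathcal V^1)$: a finite set of configurations $\mathcal V$, moves $\mathcal E\subseteq\mathcal V\times\mathcal V$, and a partition of $\mathcal V$ into configurations controlled by player 0 (Alice) and player 1 (Bob). A play is a non-empty finite or infinite walk in $(\mathcal V,\mathcal E)$. A strategy for player $P$ is a map $s\colon\mathcal V^P\to\mathcal V\cup\{\bot\}$ with $(\sigma,s(\sigma))\in\mathcal E$ or $s(\sigma)=\bot$; a play conforms to $s$ if at each $\sigma_i\in\mathcal V^P$ either $\sigma_{i+1}=s(\sigma_i)\ne\bot$, or $s(\sigma_i)=\bot$ and $\sigma_i$ is the last configuration. A reachability game is $(\mathcal G,\mathcal F)$ with $\mathcal F=(\mathcal F^0,\mathcal F^1)$ a partition of $\mathcal V$. A play is winning for $P$ if finite with last configuration in $\mathcal F^P$, surviving for $P$ if winning for $P$ or infinite. $\mathcal W^P$ (resp. $\mathcal S^P$) is the set of configurations $\sigma_0$ from which $P$ has a strategy all of whose conforming plays from $\sigma_0$ are winning (resp. surviving) for $P$. For finite directed graphs $G_0=(V_0,E_0)$, $G_1=(V_1,E_1)$, $\mathcal G(G_0,G_1)$ has configurations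 $\mathcal V^P=\{\langle P,u,v\rangle:u\in V_P,v\in V_{1-P}\}$ and moves $(\langle P,u,v\rangle,\langle1-P,v,u'\rangle)$ for $(u,u')\in E_P$, $v\in V_{1-P}$. The problem 2TRG Winning Set of order $|V_0|\times|V_1|$: given $G_0,G_1$ and $\mathcal F$, compute the winning and surviving sets of $(\mathcal G(G_0,G_1),\mathcal F)$. Its Semi-Acyclic variant requires at least one of $G_0,G_1$ to be acyclic. Verifying the problem means deciding, given an instance and candidate sets, whether they equal the correct output. A Kripke structure is $(S,T,L)$ with finite state set $S$, transitions $T\subseteq S\times S$ and labeling $L$ on $S$. Its simulation game is the reachability game on $\mathcal G(G,G)$, $G=(S,T)$, with $\mathcal F^1=\{\langle 0,s,t\rangle: L(s)=L(t)\}$ and $\mathcal F^0$ the complement; $t$ simulates $s$ iff $\langle 0,s,t\rangle\in\mathcal S^1$. The problem Acyclic Simulation of order $|S|$: given $(S,T,L)$ with $(S,T)$ acyclic, compute the relation "$t$ simulates $s$" on $S\times S$. Boolean matrix product of $n\times n$ boolean matrices: $(\mathbf B_1\star\mathbf B_2)[i,j]=\bigvee_k\mathbf B_1[i,k]\wedge\mathbf B_2[k,j]$. A product verification asks whether a given candidate matrix equals the product of two given matrices; standard $(+,\times)$-matrix product verification refers to the ordinary product over the integers. *)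

theory Defs
  imports
    "HOL-Library.Landau_Symbols"
    "Jordan_Normal_Form.Matrix"
begin

section \<open>Reachability games\<close>

datatype player = Alice | Bob

fun opponent :: "player \<Rightarrow> player" where
  "opponent Alice = Bob"
| "opponent Bob = Alice"

record 'v game_graph =
  configs :: "'v set"
  moves :: "('v \<times> 'v) set"
  controlled :: "player \<Rightarrow> 'v set"

definition game_graph :: "'v game_graph \<Rightarrow> bool" where
  "game_graph G \<longleftrightarrow> finite (configs G) \<and> moves G \<subseteq> configs G \<times> configs G \<and>
     controlled G Alice \<union> controlled G Bob = configs G \<and>
     controlled G Alice \<inter> controlled G Bob = {}"

definition reachability_game :: "'v game_graph \<Rightarrow> (player \<Rightarrow> 'v set) \<Rightarrow> bool" where
  "reachability_game G F \<longleftrightarrow> game_graph G \<and>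
     F Alice \<union> F Bob = configs G \<and> F Alice \<inter> F Bob = {}"

datatype 'v play = Finite_Play "'v list" | Infinite_Play "nat \<Rightarrow> 'v"

fun is_play :: "'v game_graph \<Rightarrow> 'v play \<Rightarrow> bool" where
  "is_play G (Finite_Play xs) \<longleftrightarrow> xs \<noteq> [] \<and> set xs \<subseteq> configs G \<and>
     (\<forall>i. Suc i < length xs \<longrightarrow> (xs ! i, xs ! Suc i) \<in> moves G)"
| "is_play G (Infinite_Play f) \<longleftrightarrow> range f \<subseteq> configs G \<and> (\<forall>i. (f i, f (Suc i)) \<in> moves G)"

fun first_config :: "'v play \<Rightarrow> 'v" where
  "first_config (Finite_Play xs) = hd xs"
| "first_config (Infinite_Play f) = f 0"

text \<open>\<^term>\<open>None\<close> is the choice to stop.  The values of a strategy outside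
  \<^term>\<open>controlled G P\<close> are irrelevant.\<close>

definition strategy :: "'v game_graph \<Rightarrow> player \<Rightarrow> ('v \<Rightarrow> 'v option) \<Rightarrow> bool" where
  "strategy G P s \<longleftrightarrow> (\<forall>\<sigma>\<in>controlled G P. \<forall>\<tau>. s \<sigma> = Some \<tau> \<longrightarrow> (\<sigma>, \<tau>) \<in> moves G)"

fun conforms :: "'v game_graph \<Rightarrow> player \<Rightarrow> ('v \<Rightarrow> 'v option) \<Rightarrow> 'v play \<Rightarrow> bool" where
  "conforms G P s (Finite_Play xs) \<longleftrightarrow>
     (\<forall>i<length xs. xs ! i \<in> controlled G P \<longrightarrow>
        (case s (xs ! i) of
           None \<Rightarrow> Suc i = length xs
         | Some \<tau> \<Rightarrow> Suc i < length xs \<and> xs ! Suc i = \<tau>))"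
| "conforms G P s (Infinite_Play f) \<longleftrightarrow>
     (\<forall>i. f i \<in> controlled G P \<longrightarrow> s (f i) = Some (f (Suc i)))"

fun winning_play :: "(player \<Rightarrow> 'v set) \<Rightarrow> player \<Rightarrow> 'v play \<Rightarrow> bool" where
  "winning_play F P (Finite_Play xs) \<longleftrightarrow> last xs \<in> F P"
| "winning_play F P (Infinite_Play f) \<longleftrightarrow> False"

fun surviving_play :: "(player \<Rightarrow> 'v set) \<Rightarrow> player \<Rightarrow> 'v play \<Rightarrow> bool" where
  "surviving_play F P (Finite_Play xs) \<longleftrightarrow> winning_play F P (Finite_Play xs)"
| "surviving_play F P (Infinite_Play f) \<longleftrightarrow> True"

definition winning_set :: "'v game_graph \<Rightarrow> (player \<Rightarrow> 'v set) \<Rightarrow> player \<Rightarrow> 'v set" where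
  "winning_set G F P = {\<sigma> \<in> configs G. \<exists>s. strategy G P s \<and>
     (\<forall>p. is_play G p \<and> first_config p = \<sigma> \<and> conforms G P s p \<longrightarrow> winning_play F P p)}"

definition surviving_set :: "'v game_graph \<Rightarrow> (player \<Rightarrow> 'v set) \<Rightarrow> player \<Rightarrow> 'v set" where
  "surviving_set G F P = {\<sigma> \<in> configs G. \<exists>s. strategy G P s \<and>
     (\<forall>p. is_play G p \<and> first_config p = \<sigma> \<and> conforms G P s p \<longrightarrow> surviving_play F P p)}"


section \<open>Two-token games and simulation games\<close>

text \<open>The pair of graphs is indexed by the players: $G_0$ is \<open>(V Alice, E Alice)\<close> and
  $G_1$ is \<open>(V Bob, E Bob)\<close>.  In \<open>(P, u, v)\<close> it is \<open>P\<close> who moves next, \<open>u\<close> is the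
  position of \<open>P\<close> and \<open>v\<close> the position of the opponent.\<close>

type_synonym 'a token_config = "player \<times> 'a \<times> 'a"

definition finite_digraph :: "'a set \<Rightarrow> ('a \<times> 'a) set \<Rightarrow> bool" where
  "finite_digraph V E \<longleftrightarrow> finite V \<and> E \<subseteq> V \<times> V"

definition token_game ::
    "(player \<Rightarrow> 'a set) \<Rightarrow> (player \<Rightarrow> ('a \<times> 'a) set) \<Rightarrow> 'a token_config game_graph" where
  "token_game V E =
     \<lparr> configs = {(P, u, v) | P u v. u \<in> V P \<and> v \<in> V (opponent P)},
       moves = {((P, u, v), (opponent P, v, u')) | P u u' v. (u, u') \<in> E P \<and> v \<in> V (opponent P)},
       controlled = (\<lambda>P. {(P, u, v) | u v. u \<in> V P \<and> v \<in> V (opponent P)}) \<rparr>"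

definition trg_instance ::
    "(player \<Rightarrow> 'a set) \<Rightarrow> (player \<Rightarrow> ('a \<times> 'a) set) \<Rightarrow> (player \<Rightarrow> 'a token_config set) \<Rightarrow> bool" where
  "trg_instance V E F \<longleftrightarrow>
     (\<forall>P. finite_digraph (V P) (E P)) \<and> reachability_game (token_game V E) F"

definition semi_acyclic_trg_instance ::
    "(player \<Rightarrow> 'a set) \<Rightarrow> (player \<Rightarrow> ('a \<times> 'a) set) \<Rightarrow> (player \<Rightarrow> 'a token_config set) \<Rightarrow> bool" where
  "semi_acyclic_trg_instance V E F \<longleftrightarrow>
     trg_instance V E F \<and> (acyclic (E Alice) \<or> acyclic (E Bob))"

lemma game_graph_token_game:
  assumes "\<And>P. finite_digraph (V P) (E P)"
  shows "game_graph (token_game V E)"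
proof -
  let ?G = "token_game V E"
  have player: "P = Alice \<or> P = Bob" for P
    by (cases P) simp_all
  have opp: "opponent (opponent P) = P" for P
    by (cases P) simp_all
  have fin: "finite (V P)" for P
    using assms[of P] by (simp add: finite_digraph_def)
  have edge: "u \<in> V P \<and> u' \<in> V P" if "(u, u') \<in> E P" for P u u'
    using assms[of P] that unfolding finite_digraph_def by blast
  have configs: "configs ?G = (\<Union>P\<in>{Alice, Bob}. {P} \<times> V P \<times> V (opponent P))"
  proof (intro equalityI subsetI)
    fix x assume "x \<in> configs ?G"
    then obtain P u v where "x = (P, u, v)" "u \<in> V P" "v \<in> V (opponent P)"
      by (auto simp: token_game_def)
    then show "x \<in> (\<Union>P\<in>{Alice, Bob}. {P} \<times> V P \<times> V (opponent P))"
      using player[of P] by blast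
  qed (auto simp: token_game_def)
  have "finite (configs ?G)"
    unfolding configs using fin by blast
  moreover have "moves ?G \<subseteq> configs ?G \<times> configs ?G"
    using edge by (auto simp: token_game_def opp)
  moreover have "controlled ?G Alice \<union> controlled ?G Bob = configs ?G"
    unfolding configs by (auto simp: token_game_def)
  moreover have "controlled ?G Alice \<inter> controlled ?G Bob = {}"
    by (auto simp: token_game_def)
  ultimately show ?thesis
    by (simp add: game_graph_def)
qed

definition simulation_graph :: "'s set \<Rightarrow> ('s \<times> 's) set \<Rightarrow> 's token_config game_graph" where
  "simulation_graph S T = token_game (\<lambda>_. S) (\<lambda>_. T)"

definition simulation_goal ::
    "'s set \<Rightarrow> ('s \<times> 's) set \<Rightarrow> ('s \<Rightarrow> 'l) \<Rightarrow> player \<Rightarrow> 's token_config set" where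
  "simulation_goal S T L P =
     (let F1 = {(Alice, s, t) | s t. s \<in> S \<and> t \<in> S \<and> L s = L t}
      in case P of Bob \<Rightarrow> F1 | Alice \<Rightarrow> configs (simulation_graph S T) - F1)"

lemma reachability_game_simulation:
  assumes "finite_digraph S T"
  shows "reachability_game (simulation_graph S T) (simulation_goal S T L)"
proof -
  have "game_graph (simulation_graph S T)"
    unfolding simulation_graph_def by (rule game_graph_token_game) (rule assms)
  moreover have "simulation_goal S T L Bob \<subseteq> configs (simulation_graph S T)"
    by (auto simp: simulation_goal_def simulation_graph_def token_game_def)
  moreover have "simulation_goal S T L Alice
      = configs (simulation_graph S T) - simulation_goal S T L Bob"
    by (simp add: simulation_goal_def)
  ultimately show ?thesis
    unfolding reachability_game_def by blast
qed

definition simulates ::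
    "'s set \<Rightarrow> ('s \<times> 's) set \<Rightarrow> ('s \<Rightarrow> 'l) \<Rightarrow> 's \<Rightarrow> 's \<Rightarrow> bool" where
  "simulates S T L t s \<longleftrightarrow>
     (Alice, s, t) \<in> surviving_set (simulation_graph S T) (simulation_goal S T L) Bob"


section \<open>Matrix product verification\<close>

definition bool_mat_mult :: "bool mat \<Rightarrow> bool mat \<Rightarrow> bool mat" (infixl "\<star>" 70) where
  "A \<star> B = mat (dim_row A) (dim_col B) (\<lambda>(i, j). \<exists>k<dim_col A. A $$ (i, k) \<and> B $$ (k, j))"

text \<open>Matrices are stored row by row in arrays of machine words.  A query problem takes the
  dimension and three arrays and asks whether the third matrix is the product of the
  first two.  Words are non-negative, so \<open>int_mpv\<close> is asked about matrices of
  non-negative integers only.\<close>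

type_synonym query_problem = "nat \<Rightarrow> (nat \<Rightarrow> nat) \<Rightarrow> (nat \<Rightarrow> nat) \<Rightarrow> (nat \<Rightarrow> nat) \<Rightarrow> bool"

definition bool_mat_of :: "nat \<Rightarrow> (nat \<Rightarrow> nat) \<Rightarrow> bool mat" where
  "bool_mat_of d a = mat d d (\<lambda>(i, j). a (i * d + j) \<noteq> 0)"

definition int_mat_of :: "nat \<Rightarrow> (nat \<Rightarrow> nat) \<Rightarrow> int mat" where
  "int_mat_of d a = mat d d (\<lambda>(i, j). int (a (i * d + j)))"

definition bool_mpv :: query_problem where
  "bool_mpv d a b c \<longleftrightarrow> bool_mat_of d c = bool_mat_of d a \<star> bool_mat_of d b"

definition int_mpv :: query_problem where
  "int_mpv d a b c \<longleftrightarrow> int_mat_of d c = int_mat_of d a * int_mat_of d b"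


section \<open>Word RAM programs with queries\<close>

text \<open>A machine has \<open>w\<close>-bit words, unit-cost arithmetic modulo \<open>2 ^ w\<close>, registers, and
  arrays with indirect addressing; a program can name only finitely many registers and
  arrays.  \<open>Query r e a b c\<close> writes the answer for dimension \<open>e\<close> and arrays \<open>a\<close>, \<open>b\<close>, \<open>c\<close>,
  as 0 or 1, to register \<open>r\<close>.\<close>

datatype aexp =
    Const nat
  | Reg nat
  | Load nat aexp
  | Add aexp aexp
  | Sub aexp aexp
  | Mul aexp aexp
  | Less aexp aexp
  | Equal aexp aexp

datatype com =
    Skip
  | Assign nat aexp
  | Store nat aexp aexp
  | Seq com com
  | Cond aexp com com
  | While aexp com
  | Query nat aexp nat nat nat

record store =
  reg :: "nat \<Rightarrow> nat"
  arr :: "nat \<Rightarrow> nat \<Rightarrow> nat"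

fun aval :: "nat \<Rightarrow> store \<Rightarrow> aexp \<Rightarrow> nat" where
  "aval w s (Const k) = k mod 2 ^ w"
| "aval w s (Reg r) = reg s r"
| "aval w s (Load a e) = arr s a (aval w s e)"
| "aval w s (Add e f) = (aval w s e + aval w s f) mod 2 ^ w"
| "aval w s (Sub e f) = nat ((int (aval w s e) - int (aval w s f)) mod 2 ^ w)"
| "aval w s (Mul e f) = (aval w s e * aval w s f) mod 2 ^ w"
| "aval w s (Less e f) = of_bool (aval w s e < aval w s f)"
| "aval w s (Equal e f) = of_bool (aval w s e = aval w s f)"

fun acost :: "aexp \<Rightarrow> nat" where
  "acost (Const k) = 1"
| "acost (Reg r) = 1"
| "acost (Load a e) = acost e + 1"
| "acost (Add e f) = acost e + acost f + 1"
| "acost (Sub e f) = acost e + acost f + 1"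
| "acost (Mul e f) = acost e + acost f + 1"
| "acost (Less e f) = acost e + acost f + 1"
| "acost (Equal e f) = acost e + acost f + 1"

text \<open>In \<open>exec qp w c s t qs s'\<close>, the program \<open>c\<close> started in \<open>s\<close> terminates in \<open>s'\<close> after
  \<open>t\<close> time units, and \<open>qs\<close> lists the dimensions of its queries.  The time to answer
  a query is not part of \<open>t\<close>.\<close>

inductive exec :: "query_problem \<Rightarrow> nat \<Rightarrow> com \<Rightarrow> store \<Rightarrow> nat \<Rightarrow> nat list \<Rightarrow> store \<Rightarrow> bool"
  for qp :: query_problem and w :: nat where
  Skip: "exec qp w Skip s 1 [] s"
| Assign: "exec qp w (Assign r e) s (acost e + 1) [] (s\<lparr>reg := (reg s)(r := aval w s e)\<rparr>)"
| Store: "exec qp w (Store a i e) s (acost i + acost e + 1) []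
    (s\<lparr>arr := (arr s)(a := (arr s a)(aval w s i := aval w s e))\<rparr>)"
| Seq: "exec qp w c s t qs s' \<Longrightarrow> exec qp w c' s' t' qs' s'' \<Longrightarrow>
    exec qp w (Seq c c') s (t + t') (qs @ qs') s''"
| CondTrue: "aval w s e \<noteq> 0 \<Longrightarrow> exec qp w c s t qs s' \<Longrightarrow>
    exec qp w (Cond e c c') s (acost e + 1 + t) qs s'"
| CondFalse: "aval w s e = 0 \<Longrightarrow> exec qp w c' s t qs s' \<Longrightarrow>
    exec qp w (Cond e c c') s (acost e + 1 + t) qs s'"
| WhileTrue: "aval w s e \<noteq> 0 \<Longrightarrow> exec qp w c s t qs s' \<Longrightarrow>
    exec qp w (While e c) s' t' qs' s'' \<Longrightarrow>
    exec qp w (While e c) s (acost e + 1 + t + t') (qs @ qs') s''"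
| WhileFalse: "aval w s e = 0 \<Longrightarrow> exec qp w (While e c) s (acost e + 1) [] s"
| Query: "exec qp w (Query r e a b c) s (acost e + 1) [aval w s e]
    (s\<lparr>reg := (reg s)(r := of_bool (qp (aval w s e) (arr s a) (arr s b) (arr s c)))\<rparr>)"

inductive_cases exec_SkipE: "exec qp w Skip s t qs s'"
inductive_cases exec_AssignE: "exec qp w (Assign r e) s t qs s'"
inductive_cases exec_StoreE: "exec qp w (Store a i e) s t qs s'"
inductive_cases exec_SeqE: "exec qp w (Seq c c') s t qs s'"
inductive_cases exec_CondE: "exec qp w (Cond e c c') s t qs s'"
inductive_cases exec_WhileE: "exec qp w (While e c) s t qs s'"
inductive_cases exec_QueryE: "exec qp w (Query r e a b c) s t qs s'"

lemma exec_deterministic: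
  assumes "exec qp w c s t qs s'" and "exec qp w c s t' qs' s''"
  shows "t = t' \<and> qs = qs' \<and> s' = s''"
  using assms
proof (induction arbitrary: t' qs' s'' rule: exec.induct)
  case Skip
  then show ?case by (rule exec_SkipE) simp
next
  case Assign
  then show ?case by (rule exec_AssignE) simp
next
  case Store
  then show ?case by (rule exec_StoreE) simp
next
  case (Seq c s t qs s' c' u qs2 s2)
  from Seq.prems show ?case
  proof (rule exec_SeqE)
    fix t1 qs1 s1 t2 qs3
    assume *: "t' = t1 + t2" "qs' = qs1 @ qs3"
      and 1: "exec qp w c s t1 qs1 s1" and 2: "exec qp w c' s1 t2 qs3 s''"
    from Seq.IH(1)[OF 1] 2 have "exec qp w c' s' t2 qs3 s''" by simp
    from Seq.IH(2)[OF this] Seq.IH(1)[OF 1] * show ?thesis by simp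
  qed
next
  case (CondTrue s e c t qs s' c')
  from CondTrue.prems show ?case
  proof (rule exec_CondE)
    fix t1
    assume "0 < aval w s e" "t' = Suc (acost e + t1)" "exec qp w c s t1 qs' s''"
    then show ?thesis using CondTrue.IH by simp
  qed (use CondTrue.hyps in simp)
next
  case (CondFalse s e c' t qs s' c)
  from CondFalse.prems show ?case
  proof (rule exec_CondE)
    fix t1
    assume "aval w s e = 0" "t' = Suc (acost e + t1)" "exec qp w c' s t1 qs' s''"
    then show ?thesis using CondFalse.IH by simp
  qed (use CondFalse.hyps in simp)
next
  case (WhileTrue s e c t qs s' u qs2 s2)
  from WhileTrue.prems show ?case
  proof (rule exec_WhileE)
    fix t1 qs1 s1 t2 qs3
    assume "0 < aval w s e" and *: "t' = Suc (acost e + t1 + t2)" "qs' = qs1 @ qs3"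
      and 1: "exec qp w c s t1 qs1 s1" and 2: "exec qp w (While e c) s1 t2 qs3 s''"
    from WhileTrue.IH(1)[OF 1] 2 have "exec qp w (While e c) s' t2 qs3 s''" by simp
    from WhileTrue.IH(2)[OF this] WhileTrue.IH(1)[OF 1] * show ?thesis by simp
  qed (use WhileTrue.hyps in simp)
next
  case (WhileFalse s e c)
  from WhileFalse.prems show ?case
    by (rule exec_WhileE) (use WhileFalse.hyps in auto)
next
  case Query
  then show ?case by (rule exec_QueryE) simp
qed

definition initial_store :: "nat \<Rightarrow> nat list list \<Rightarrow> store" where
  "initial_store n x =
     \<lparr> reg = (\<lambda>r. if r = 0 then n else 0),
       arr = (\<lambda>a i. if a < length x \<and> i < length (x ! a) then x ! a ! i else 0) \<rparr>"

definition decides_within ::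
    "query_problem \<Rightarrow> nat \<Rightarrow> com \<Rightarrow> nat \<Rightarrow> nat list list \<Rightarrow> nat \<Rightarrow> nat \<Rightarrow> nat \<Rightarrow> bool \<Rightarrow> bool" where
  "decides_within qp w c n x t k d ans \<longleftrightarrow>
     (\<exists>t' qs s'. exec qp w c (initial_store n x) t' qs s' \<and>
        t' \<le> t \<and> length qs \<le> k \<and> (\<forall>q\<in>set qs. q \<le> d) \<and> (ans \<longleftrightarrow> reg s' 0 = 1))"


section \<open>Verification via matrix product verification\<close>

text \<open>A verification task is a set of triples: the order \<open>n\<close>, an instance together with a
  candidate output (encoded as arrays of words), and whether the candidate is correct.
  The word length is only assumed to be at least some constant multiple of \<open>log (n + 2)\<close>
  and sufficient for the words of the input.  Sizes of matrix products are meant up to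
  constant factors: constantly many queries of dimension \<open>O(n)\<close> are allowed, with a time of
  \<open>O(n\<^sup>2)\<close> for everything else.\<close>

type_synonym verification_task = "(nat \<times> nat list list \<times> bool) set"

definition words :: "nat \<Rightarrow> nat list \<Rightarrow> bool" where
  "words w xs \<longleftrightarrow> (\<forall>v\<in>set xs. v < 2 ^ w)"

definition verifiable_via :: "query_problem \<Rightarrow> verification_task \<Rightarrow> bool" where
  "verifiable_via qp A \<longleftrightarrow>
     (\<exists>prog time dim calls wl.
        (\<lambda>n. real (time n)) \<in> O(\<lambda>n. real n ^ 2) \<and>
        (\<lambda>n. real (dim n)) \<in> O(\<lambda>n. real n) \<and>
        (\<forall>(n, x, correct)\<in>A. \<forall>w. (n + 2) ^ wl \<le> 2 ^ w \<and> (\<forall>a\<in>set x. words w a) \<longrightarrow>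
           decides_within qp w prog n x (time n) calls (dim n) correct))"

text \<open>The certificate is an additional array, placed after the arrays of the input.\<close>

definition certifiable_via :: "query_problem \<Rightarrow> verification_task \<Rightarrow> bool" where
  "certifiable_via qp A \<longleftrightarrow>
     (\<exists>prog csize time dim calls wl.
        (\<lambda>n. real (csize n)) \<in> O(\<lambda>n. real n ^ 2) \<and>
        (\<lambda>n. real (time n)) \<in> O(\<lambda>n. real n ^ 2) \<and>
        (\<lambda>n. real (dim n)) \<in> O(\<lambda>n. real n) \<and>
        (\<forall>(n, x, correct)\<in>A. \<forall>w. (n + 2) ^ wl \<le> 2 ^ w \<and> (\<forall>a\<in>set x. words w a) \<longrightarrow>
           (let certs = {z. length z \<le> csize n \<and> words w z};
                verdict = (\<lambda>z. decides_within qp w prog n (x @ [z]) (time n) calls (dim n))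
            in (\<forall>z\<in>certs. \<exists>ans. verdict z ans) \<and>
               (correct \<longleftrightarrow> (\<exists>z\<in>certs. verdict z True)))))"


section \<open>The verification tasks\<close>

text \<open>Vertices of a graph of order \<open>n\<close> are numbered \<open>0, \<dots>, n - 1\<close>; graphs and relations are
  given by adjacency matrices, sets of configurations by one matrix for each player.\<close>

definition rel_bits :: "nat \<Rightarrow> (nat \<times> nat) set \<Rightarrow> nat list" where
  "rel_bits n R = map (\<lambda>k. of_bool ((k div n, k mod n) \<in> R)) [0..<n * n]"

definition config_bits :: "nat \<Rightarrow> nat token_config set \<Rightarrow> nat list" where
  "config_bits n X =
     rel_bits n {(u, v). (Alice, u, v) \<in> X} @ rel_bits n {(u, v). (Bob, u, v) \<in> X}"

definition semi_acyclic_trg_verification :: verification_task where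
  "semi_acyclic_trg_verification =
     {(n,
       [rel_bits n (E Alice), rel_bits n (E Bob),
        config_bits n (F Alice), config_bits n (F Bob),
        config_bits n (W Alice), config_bits n (W Bob),
        config_bits n (S Alice), config_bits n (S Bob)],
       \<forall>P. W P = winning_set (token_game V E) F P \<and> S P = surviving_set (token_game V E) F P)
     | n V E F W S.
       V = (\<lambda>_. {..<n}) \<and> semi_acyclic_trg_instance V E F \<and>
       (\<forall>P. W P \<subseteq> configs (token_game V E) \<and> S P \<subseteq> configs (token_game V E))}"

definition acyclic_simulation_verification :: verification_task where
  "acyclic_simulation_verification =
     {(n,
       [rel_bits n T, map L [0..<n], rel_bits n R],
       R = {(s, t) \<in> S \<times> S. simulates S T L t s})
     | n S T (L :: nat \<Rightarrow> nat) R.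
       S = {..<n} \<and> finite_digraph S T \<and> acyclic T \<and> R \<subseteq> S \<times> S}"

end

theory Submission
  imports Defs
begin

text \<open>
  If one of the two graphs is acyclic, every play is finite, so surviving and winning coincide,
  the game is determined, and Bob's winning set is the unique solution \<open>X\<close> of the equations
  that describe a single move.  For \<open>x0 u v\<close> and \<open>x1 u v\<close> denoting membership in \<open>X\<close> of
  \<open>(Alice, u, v)\<close> and \<open>(Bob, u, v)\<close>, they are \<open>\<not> x0 = f0 \<or> E0 \<star> (\<not> x1)\<^sup>T\<close> and
  \<open>x1 = f1 \<or> E1 \<star> x0\<^sup>T\<close>, where \<open>f0\<close> and \<open>f1\<close> tell where the player to move may stop and win.
  So checking a candidate means verifying two boolean products; the disjunctions become
  part of the products when the dimension is doubled.  For the standard product, the certificate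
  consists of the two integer products, whose non-zero entries give the boolean ones.
  For simulation, only \<open>x0\<close> is given, and \<open>x1\<close> is read off the first integer product.
\<close>

section \<open>Reachability games with well-founded moves\<close>

text \<open>Where infinite plays exist, the one-move equations may have several solutions.
  Uniqueness comes from a symmetry: the complement of a solution solves the equations of the
  opponent, each of the two lies inside the winning set of its player, and these winning sets are
  disjoint. Alice's equation is negated because her moves put a universal quantifier into Bob's
  condition, whereas a product offers an existential one. The disjunction with \<open>f\<close>
  cannot be stripped off entrywise: where \<open>f\<close> holds, the candidate says nothing about
  the bare product, so the verifier does not know that matrix. An identity block turns
  \<open>f\<close> into a summand of the product. An integer product holds counts of good moves,
  which a 0/1 candidate does not determine; hence the certificate. The queries admit only the true
  counts, so a certificate cannot cheat, and the counts are at most \<open>n + 1\<close>, so each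
  fits into a word.\<close>

lemma opponent_opponent [simp]: "opponent (opponent P) = P"
  by (cases P) simp_all

lemma opponent_neq [simp]: "opponent P \<noteq> P" "P \<noteq> opponent P"
  by (cases P; simp)+

lemma all_player: "(\<forall>P. Q P) \<longleftrightarrow> Q Alice \<and> Q Bob"
  by (metis player.exhaust)

lemma player_neq_iff: "Q \<noteq> P \<longleftrightarrow> Q = opponent P"
  by (cases P; cases Q) simp_all

lemma game_graph_controlled:
  assumes "game_graph G" "\<sigma> \<in> configs G"
  shows "\<sigma> \<in> controlled G (opponent P) \<longleftrightarrow> \<sigma> \<notin> controlled G P"
  using assms by (cases P) (auto simp: game_graph_def)

lemma is_play_Cons:
  assumes "is_play G (Finite_Play xs)" "(\<sigma>, hd xs) \<in> moves G" "\<sigma> \<in> configs G"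
  shows "is_play G (Finite_Play (\<sigma> # xs))"
  using assms by (auto simp: nth_Cons hd_conv_nth split: nat.split)

lemma conforms_Cons:
  assumes "xs \<noteq> []" "conforms G P s (Finite_Play xs)"
    "\<sigma> \<in> controlled G P \<Longrightarrow> s \<sigma> = Some (hd xs)"
  shows "conforms G P s (Finite_Play (\<sigma> # xs))"
proof -
  have "case s ((\<sigma> # xs) ! i) of None \<Rightarrow> Suc i = length (\<sigma> # xs)
      | Some \<tau> \<Rightarrow> Suc i < length (\<sigma> # xs) \<and> (\<sigma> # xs) ! Suc i = \<tau>"
    if "i < length (\<sigma> # xs)" "(\<sigma> # xs) ! i \<in> controlled G P" for i
  proof (cases i)
    case 0
    then show ?thesis using assms(1,3) that by (simp add: hd_conv_nth)
  next
    case (Suc j)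
    then show ?thesis using assms(2) that by (auto split: option.splits)
  qed
  then show ?thesis by simp
qed

text \<open>Pitting a strategy against one of the opponent produces a play; it is finite because
  the moves are well-founded.\<close>

lemma joint_play_exists:
  assumes G: "game_graph G" and wf: "wf ((moves G)\<inverse>)"
    and s: "strategy G P s" and s': "strategy G (opponent P) s'"
    and "\<sigma> \<in> configs G"
  shows "\<exists>xs. is_play G (Finite_Play xs) \<and> hd xs = \<sigma> \<and>
    conforms G P s (Finite_Play xs) \<and> conforms G (opponent P) s' (Finite_Play xs)"
  using wf \<open>\<sigma> \<in> configs G\<close>
proof (induction \<sigma> rule: wf_induct_rule)
  case (less \<sigma>)
  define m where "m = (if \<sigma> \<in> controlled G P then s \<sigma> else s' \<sigma>)"
  note ctrl = game_graph_controlled[OF G less.prems, of P]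
  show ?case
  proof (cases m)
    case None
    then show ?thesis using less.prems ctrl
      by (intro exI[of _ "[\<sigma>]"]) (auto simp: m_def)
  next
    case (Some \<tau>)
    then have move: "(\<sigma>, \<tau>) \<in> moves G"
      using s s' ctrl unfolding strategy_def m_def by (auto split: if_splits)
    moreover have "\<tau> \<in> configs G" using move G by (auto simp: game_graph_def)
    ultimately obtain xs where xs: "is_play G (Finite_Play xs)" "hd xs = \<tau>"
      "conforms G P s (Finite_Play xs)" "conforms G (opponent P) s' (Finite_Play xs)"
      using less.IH[of \<tau>] by auto
    have "xs \<noteq> []" using xs(1) by simp
    then show ?thesis using xs move less.prems Some ctrl
      by (intro exI[of _ "\<sigma> # xs"] conjI is_play_Cons conforms_Cons)
        (auto simp: m_def)
  qed
qed

section \<open>One-move equations and determinacy\<close>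

text \<open>A fixed point of the one-move operator. Where the opponent moves, membership in
  \<open>F P\<close> is demanded even if moves exist, since the opponent may stop at any
  time.\<close>

definition game_solution ::
    "'v game_graph \<Rightarrow> (player \<Rightarrow> 'v set) \<Rightarrow> player \<Rightarrow> 'v set \<Rightarrow> bool" where
  "game_solution G F P X \<longleftrightarrow> X \<subseteq> configs G \<and>
     (\<forall>\<sigma>\<in>configs G. \<sigma> \<in> X \<longleftrightarrow>
        (if \<sigma> \<in> controlled G P then \<sigma> \<in> F P \<or> (\<exists>\<tau>. (\<sigma>, \<tau>) \<in> moves G \<and> \<tau> \<in> X)
         else \<sigma> \<in> F P \<and> (\<forall>\<tau>. (\<sigma>, \<tau>) \<in> moves G \<longrightarrow> \<tau> \<in> X)))"

text \<open>The least fixed point; it serves to show that a solution exists.\<close>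

inductive_set attractor :: "'v game_graph \<Rightarrow> (player \<Rightarrow> 'v set) \<Rightarrow> player \<Rightarrow> 'v set"
  for G F P where
  stop: "\<sigma> \<in> configs G \<Longrightarrow> \<sigma> \<in> controlled G P \<Longrightarrow> \<sigma> \<in> F P \<Longrightarrow> \<sigma> \<in> attractor G F P"
| move: "\<sigma> \<in> configs G \<Longrightarrow> \<sigma> \<in> controlled G P \<Longrightarrow> (\<sigma>, \<tau>) \<in> moves G \<Longrightarrow>
    \<tau> \<in> attractor G F P \<Longrightarrow> \<sigma> \<in> attractor G F P"
| forced: "\<sigma> \<in> configs G \<Longrightarrow> \<sigma> \<notin> controlled G P \<Longrightarrow> \<sigma> \<in> F P \<Longrightarrow>
    (\<And>\<tau>. (\<sigma>, \<tau>) \<in> moves G \<Longrightarrow> \<tau> \<in> attractor G F P) \<Longrightarrow> \<sigma> \<in> attractor G F P"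

lemma game_solution_attractor: "game_solution G F P (attractor G F P)"
proof -
  have "attractor G F P \<subseteq> configs G"
    by (auto elim: attractor.cases)
  then show ?thesis
    unfolding game_solution_def
    by (auto intro: attractor.intros elim: attractor.cases)
qed

text \<open>De Morgan: \<open>F\<close> is a partition and so is control, hence negating the
  equation swaps the two cases together with their quantifiers.\<close>

lemma game_solution_complement:
  assumes "reachability_game G F" "game_solution G F P X"
  shows "game_solution G F (opponent P) (configs G - X)"
proof -
  have G: "game_graph G" and F: "\<And>\<sigma>. \<sigma> \<in> configs G \<Longrightarrow> \<sigma> \<in> F (opponent P) \<longleftrightarrow> \<sigma> \<notin> F P"
    using assms(1) by (cases P; auto simp: reachability_game_def)+
  have conf: "\<tau> \<in> configs G" if "(\<sigma>, \<tau>) \<in> moves G" for \<sigma> \<tau>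
    using G that by (auto simp: game_graph_def)
  have "\<sigma> \<in> configs G - X \<longleftrightarrow> (if \<sigma> \<in> controlled G (opponent P)
      then \<sigma> \<in> F (opponent P) \<or> (\<exists>\<tau>. (\<sigma>, \<tau>) \<in> moves G \<and> \<tau> \<in> configs G - X)
      else \<sigma> \<in> F (opponent P) \<and> (\<forall>\<tau>. (\<sigma>, \<tau>) \<in> moves G \<longrightarrow> \<tau> \<in> configs G - X))"
    if \<sigma>: "\<sigma> \<in> configs G" for \<sigma>
  proof -
    have "\<sigma> \<in> X \<longleftrightarrow>
        (if \<sigma> \<in> controlled G P then \<sigma> \<in> F P \<or> (\<exists>\<tau>. (\<sigma>, \<tau>) \<in> moves G \<and> \<tau> \<in> X)
         else \<sigma> \<in> F P \<and> (\<forall>\<tau>. (\<sigma>, \<tau>) \<in> moves G \<longrightarrow> \<tau> \<in> X))"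
      using assms(2) \<sigma> unfolding game_solution_def by blast
    then show ?thesis
      using conf F[OF \<sigma>] game_graph_controlled[OF G \<sigma>, of P] \<sigma>
      by (cases "\<sigma> \<in> controlled G P") (simp_all, blast+)
  qed
  then show ?thesis unfolding game_solution_def by blast
qed

text \<open>From \<open>X\<close>, player \<open>P\<close> stops as soon as \<open>F P\<close> holds
  and otherwise moves within \<open>X\<close>; the opponent cannot leave \<open>X\<close> and can
  stop only in \<open>F P\<close>. Well-foundedness excludes infinite plays.\<close>

lemma game_solution_subset_winning_set:
  assumes G: "game_graph G" and wf: "wf ((moves G)\<inverse>)" and X: "game_solution G F P X"
  shows "X \<subseteq> winning_set G F P"
proof
  fix \<sigma> assume "\<sigma> \<in> X"
  define s where "s \<sigma> = (if \<sigma> \<in> F P then None else Some (SOME \<tau>. (\<sigma>, \<tau>) \<in> moves G \<and> \<tau> \<in> X))" for \<sigma>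
  have sol: "\<sigma> \<in> X \<longleftrightarrow>
        (if \<sigma> \<in> controlled G P then \<sigma> \<in> F P \<or> (\<exists>\<tau>. (\<sigma>, \<tau>) \<in> moves G \<and> \<tau> \<in> X)
         else \<sigma> \<in> F P \<and> (\<forall>\<tau>. (\<sigma>, \<tau>) \<in> moves G \<longrightarrow> \<tau> \<in> X))" if "\<sigma> \<in> configs G" for \<sigma>
    using X that unfolding game_solution_def by blast
  have XV: "X \<subseteq> configs G" using X by (simp add: game_solution_def)
  have move: "(\<sigma>, \<tau>) \<in> moves G \<and> \<tau> \<in> X"
    if "\<sigma> \<in> X" "\<sigma> \<in> controlled G P" "s \<sigma> = Some \<tau>" for \<sigma> \<tau>
  proof -
    have "\<sigma> \<notin> F P" and \<tau>: "\<tau> = (SOME \<tau>. (\<sigma>, \<tau>) \<in> moves G \<and> \<tau> \<in> X)"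
      using that(3) by (auto simp: s_def split: if_splits)
    then have "\<exists>\<tau>. (\<sigma>, \<tau>) \<in> moves G \<and> \<tau> \<in> X"
      using sol[of \<sigma>] that XV by auto
    then show ?thesis unfolding \<tau> by (rule someI_ex)
  qed
  \<comment> \<open>Outside \<open>X\<close> the choice made by \<open>SOME\<close> need not be a
    move, so the strategy stops there by default.\<close>
  define s' where "s' \<sigma> = (if \<sigma> \<in> X then s \<sigma> else None)" for \<sigma>
  have "strategy G P s'"
    using move by (auto simp: strategy_def s'_def split: if_splits)
  moreover have "winning_play F P p"
    if p: "is_play G p" "first_config p = \<sigma>" "conforms G P s' p" for p
  proof (cases p)
    case (Finite_Play xs)
    have conf: "case s' (xs ! i) of None \<Rightarrow> Suc i = length xs
        | Some \<tau> \<Rightarrow> Suc i < length xs \<and> xs ! Suc i = \<tau>"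
      if "i < length xs" "xs ! i \<in> controlled G P" for i
      using p(3) Finite_Play that by simp
    have inX: "i < length xs \<Longrightarrow> xs ! i \<in> X" for i
    proof (induction i)
      case 0
      then show ?case using p \<open>\<sigma> \<in> X\<close> Finite_Play by (simp add: hd_conv_nth)
    next
      case (Suc i)
      then have i: "xs ! i \<in> X" "(xs ! i, xs ! Suc i) \<in> moves G"
        using p(1) Finite_Play by auto
      show ?case
      proof (cases "xs ! i \<in> controlled G P")
        case True
        then have "s (xs ! i) = Some (xs ! Suc i)"
          using conf[of i] i Suc.prems by (auto simp: s'_def split: option.splits)
        then show ?thesis using move i(1) True by blast
      next
        case False
        then show ?thesis using sol[of "xs ! i"] i XV by auto
      qed
    qed
    have ne: "xs \<noteq> []" using p(1) Finite_Play by simp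
    define i where "i = length xs - 1"
    have i: "i < length xs" "Suc i = length xs" "last xs = xs ! i"
      using ne by (auto simp: i_def last_conv_nth)
    have lX: "xs ! i \<in> X" using inX i by blast
    have "xs ! i \<in> F P"
    proof (cases "xs ! i \<in> controlled G P")
      case True
      then have "s (xs ! i) = None"
        using conf[of i] i lX by (auto simp: s'_def split: option.splits)
      then show ?thesis by (simp add: s_def split: if_splits)
    next
      case False
      then show ?thesis using sol[of "xs ! i"] lX XV by auto
    qed
    then show ?thesis using Finite_Play i by simp
  next
    case (Infinite_Play f)
    then have "(f (Suc i), f i) \<in> (moves G)\<inverse>" for i using p by simp
    then show ?thesis using wf by (auto simp: wf_iff_no_infinite_down_chain)
  qed
  ultimately show "\<sigma> \<in> winning_set G F P"
    using \<open>\<sigma> \<in> X\<close> XV unfolding winning_set_def by blast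
qed

lemma winning_set_subset_surviving_set: "winning_set G F P \<subseteq> surviving_set G F P"
proof -
  have "winning_play F P p \<Longrightarrow> surviving_play F P p" for p :: "'a play"
    by (cases p) simp_all
  then show ?thesis unfolding winning_set_def surviving_set_def by blast
qed

text \<open>The joint play of the two strategies is finite, so its last configuration would lie in
  both goals.\<close>

lemma surviving_set_disjoint_winning_set:
  assumes "reachability_game G F" "wf ((moves G)\<inverse>)"
  shows "surviving_set G F P \<inter> winning_set G F (opponent P) = {}"
proof (rule ccontr)
  assume "\<not> ?thesis"
  then obtain \<sigma> s s' where \<sigma>: "\<sigma> \<in> configs G"
    and s: "strategy G P s" "\<And>p. is_play G p \<Longrightarrow> first_config p = \<sigma> \<Longrightarrow> conforms G P s p \<Longrightarrow>
      surviving_play F P p"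
    and s': "strategy G (opponent P) s'" "\<And>p. is_play G p \<Longrightarrow> first_config p = \<sigma> \<Longrightarrow>
      conforms G (opponent P) s' p \<Longrightarrow> winning_play F (opponent P) p"
    unfolding winning_set_def surviving_set_def by blast
  obtain xs where xs: "is_play G (Finite_Play xs)" "hd xs = \<sigma>"
    "conforms G P s (Finite_Play xs)" "conforms G (opponent P) s' (Finite_Play xs)"
    using joint_play_exists[OF _ assms(2) s(1) s'(1) \<sigma>] assms(1)
    by (auto simp: reachability_game_def)
  have "last xs \<in> F P" "last xs \<in> F (opponent P)"
    using s(2)[OF xs(1) _ xs(3)] s'(2)[OF xs(1) _ xs(4)] xs(2) by simp_all
  then show False
    using assms(1) by (cases P) (auto simp: reachability_game_def)
qed

text \<open>A sandwich: \<open>X\<close> lies in the winning set, that in the surviving set, and the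
  latter in \<open>X\<close>, because everything outside \<open>X\<close> is won by the
  opponent.\<close>

lemma game_solution_unique:
  assumes R: "reachability_game G F" and wf: "wf ((moves G)\<inverse>)" and X: "game_solution G F P X"
  shows "winning_set G F P = X" "surviving_set G F P = X"
proof -
  have G: "game_graph G" using R by (simp add: reachability_game_def)
  have "configs G - X \<subseteq> winning_set G F (opponent P)"
    by (rule game_solution_subset_winning_set[OF G wf game_solution_complement[OF R X]])
  then have "surviving_set G F P \<subseteq> X"
    using surviving_set_disjoint_winning_set[OF R wf, of P]
    unfolding surviving_set_def by blast
  moreover have "X \<subseteq> winning_set G F P"
    by (rule game_solution_subset_winning_set[OF G wf X])
  ultimately show "winning_set G F P = X" "surviving_set G F P = X"
    using winning_set_subset_surviving_set[of G F P] by blast+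
qed

text \<open>All three claims follow by applying uniqueness to \<open>attractor\<close> and to its
  complement. The first one replaces a statement about strategies by a local check.\<close>

lemma wf_game_determined:
  assumes R: "reachability_game G F" and wf: "wf ((moves G)\<inverse>)"
  shows "X = winning_set G F P \<longleftrightarrow> game_solution G F P X"
    and "surviving_set G F P = winning_set G F P"
    and "winning_set G F (opponent P) = configs G - winning_set G F P"
proof -
  note att = game_solution_attractor[of G F P]
  show "X = winning_set G F P \<longleftrightarrow> game_solution G F P X"
    using game_solution_unique(1)[OF R wf] att by metis
  show "surviving_set G F P = winning_set G F P"
    using game_solution_unique[OF R wf att] by simp
  show "winning_set G F (opponent P) = configs G - winning_set G F P"
    using game_solution_unique(1)[OF R wf att]
      game_solution_unique(1)[OF R wf game_solution_complement[OF R att]] by simp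
qed

text \<open>The token on the acyclic graph advances in every other move.\<close>

lemma wf_moves_token_game:
  assumes V: "\<And>P. finite_digraph (V P) (E P)" and acyc: "acyclic (E Q)"
  shows "wf ((moves (token_game V E))\<inverse>)"
proof (rule wf_subset)
  have "finite (E Q)"
    using V[of Q] unfolding finite_digraph_def by (meson finite_SigmaI finite_subset)
  then have "wf ((E Q)\<inverse>)" using acyc by (simp add: finite_acyclic_wf_converse)
  \<comment> \<open>The rank is the position of the token of \<open>Q\<close> together with a flag.
    A move of \<open>Q\<close> follows an edge of \<open>E Q\<close>; a move of the opponent keeps
    that token and lowers the flag from 1 to 0.\<close>
  then show "wf (inv_image ((E Q)\<inverse> <*lex*> less_than)
      (\<lambda>(P, u, v). if P = Q then (u, 0) else (v, 1::nat)))" (is "wf ?r")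
    by (simp add: wf_lex_prod)
  show "(moves (token_game V E))\<inverse> \<subseteq> ?r"
    by (auto simp: token_game_def player_neq_iff)
qed

lemma semi_acyclic_game:
  assumes "semi_acyclic_trg_instance V E F"
  shows "reachability_game (token_game V E) F" "wf ((moves (token_game V E))\<inverse>)"
  using assms wf_moves_token_game[of V E]
  unfolding semi_acyclic_trg_instance_def trg_instance_def by blast+

text \<open>The equation at configurations of Alice is negated, so both right-hand sides are a
  stopping bit or an existential over edges. Moving swaps the two positions, so the bound variable
  is the second index of the other matrix; this is where the transposition comes from.\<close>

lemma semi_acyclic_winning_set_iff:
  fixes n :: nat
  assumes inst: "semi_acyclic_trg_instance (\<lambda>_. {..<n}) E F"
    and X: "X \<subseteq> configs (token_game (\<lambda>_. {..<n}) E)"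
  shows "X = winning_set (token_game (\<lambda>_. {..<n}) E) F Bob \<longleftrightarrow>
    (\<forall>u<n. \<forall>v<n.
      ((Alice, u, v) \<notin> X \<longleftrightarrow>
        (Alice, u, v) \<in> F Alice \<or> (\<exists>u'<n. (u, u') \<in> E Alice \<and> (Bob, v, u') \<notin> X)) \<and>
      ((Bob, u, v) \<in> X \<longleftrightarrow>
        (Bob, u, v) \<in> F Bob \<or> (\<exists>u'<n. (u, u') \<in> E Bob \<and> (Alice, v, u') \<in> X)))"
    (is "_ \<longleftrightarrow> (\<forall>u<n. \<forall>v<n. ?a u v \<and> ?b u v)")
proof -
  let ?G = "token_game (\<lambda>_. {..<n}) E"
  note R = semi_acyclic_game[OF inst]
  have E: "u' < n" if "(u, u') \<in> E P" for P u u'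
    using inst that
    unfolding semi_acyclic_trg_instance_def trg_instance_def finite_digraph_def by blast
  have conf: "(P, u, v) \<in> configs ?G \<longleftrightarrow> u < n \<and> v < n" for P u v
    by (auto simp: token_game_def)
  have ctrl: "(P, u, v) \<in> controlled ?G Q \<longleftrightarrow> P = Q \<and> u < n \<and> v < n" for P Q u v
    by (auto simp: token_game_def)
  have mv: "((P, u, v), \<tau>) \<in> moves ?G \<longleftrightarrow>
      v < n \<and> (\<exists>u'. (u, u') \<in> E P \<and> \<tau> = (opponent P, v, u'))" for P u v \<tau>
    by (auto simp: token_game_def)
  have F: "(P, u, v) \<in> F Bob \<longleftrightarrow> (P, u, v) \<notin> F Alice" if "u < n" "v < n" for P u v
    using R(1) that conf[of P u v] unfolding reachability_game_def by blast
  have "X = winning_set ?G F Bob \<longleftrightarrow> game_solution ?G F Bob X"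
    by (rule wf_game_determined(1)[OF R])
  also have "\<dots> \<longleftrightarrow> (\<forall>P u v. u < n \<and> v < n \<longrightarrow> ((P, u, v) \<in> X \<longleftrightarrow>
        (if P = Bob then (P, u, v) \<in> F Bob \<or> (\<exists>u'. (u, u') \<in> E P \<and> (opponent P, v, u') \<in> X)
         else (P, u, v) \<in> F Bob \<and> (\<forall>u'. (u, u') \<in> E P \<longrightarrow> (opponent P, v, u') \<in> X))))"
    using X unfolding game_solution_def
    by (simp add: conf ctrl mv Ball_def)
  also have "\<dots> \<longleftrightarrow> (\<forall>u<n. \<forall>v<n. ?a u v \<and> ?b u v)" (is "?L \<longleftrightarrow> ?R")
  proof
    assume L: ?L
    have "?a u v" "?b u v" if "u < n" "v < n" for u v
      using L[rule_format, of u v Alice] L[rule_format, of u v Bob] that E F[OF that] by auto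
    then show ?R by blast
  next
    assume R: ?R
    show ?L
    proof (intro allI impI)
      fix P u v assume uv: "u < n \<and> v < n"
      then have "?a u v" "?b u v" using R by blast+
      then show "(P, u, v) \<in> X \<longleftrightarrow>
        (if P = Bob then (P, u, v) \<in> F Bob \<or> (\<exists>u'. (u, u') \<in> E P \<and> (opponent P, v, u') \<in> X)
         else (P, u, v) \<in> F Bob \<and> (\<forall>u'. (u, u') \<in> E P \<longrightarrow> (opponent P, v, u') \<in> X))"
        using E F uv by (cases P) auto
    qed
  qed
  finally show ?thesis .
qed

section \<open>A program that builds two product queries\<close>

text \<open>These expressions read nothing that the loop of \<open>matrix_check\<close> writes while it treats a fixed
  row and column: arrays below 9 hold the input, the six arrays from 9 on the matrices of the
  queries.\<close>

fun input_expr :: "aexp \<Rightarrow> bool" where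
  "input_expr (Const k) = True"
| "input_expr (Reg r) = (r < 4)"
| "input_expr (Load a e) = (a < 9 \<and> input_expr e)"
| "input_expr (Add e f) = (input_expr e \<and> input_expr f)"
| "input_expr (Sub e f) = (input_expr e \<and> input_expr f)"
| "input_expr (Mul e f) = (input_expr e \<and> input_expr f)"
| "input_expr (Less e f) = (input_expr e \<and> input_expr f)"
| "input_expr (Equal e f) = (input_expr e \<and> input_expr f)"

lemma aval_input_expr_cong:
  assumes "input_expr e" "\<And>r. r < 4 \<Longrightarrow> reg s r = reg s' r" "\<And>a. a < 9 \<Longrightarrow> arr s a = arr s' a"
  shows "aval w s e = aval w s' e"
  using assms(1) by (induction e) (use assms(2,3) in simp_all)

fun store_all :: "nat \<Rightarrow> aexp list \<Rightarrow> com" where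
  "store_all a [] = Skip"
| "store_all a (e # es) = Seq (Store a (Reg 4) e) (store_all (Suc a) es)"

text \<open>Later expressions are evaluated after earlier stores, yet have their value in
  \<open>s\<close>: the stores only touch arrays that no \<open>input_expr\<close> reads.\<close>

lemma exec_store_all:
  assumes "\<forall>e\<in>set es. input_expr e" "9 \<le> a"
  shows "exec qp w (store_all a es) s ((\<Sum>e\<leftarrow>es. acost e + 2) + 1) []
    (s\<lparr>arr := \<lambda>b x. if a \<le> b \<and> b < a + length es \<and> x = reg s 4
       then aval w s (es ! (b - a)) else arr s b x\<rparr>)"
  using assms
proof (induction es arbitrary: a s)
  case Nil
  have "s\<lparr>arr := \<lambda>b x. if a \<le> b \<and> b < a + length [] \<and> x = reg s 4
       then aval w s ([] ! (b - a)) else arr s b x\<rparr> = s"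
    by (rule store.equality) (auto simp: fun_eq_iff)
  then show ?case using exec.Skip[of qp w s] by (simp del: One_nat_def)
next
  case (Cons e es)
  let ?s = "s\<lparr>arr := (arr s)(a := (arr s a)(reg s 4 := aval w s e))\<rparr>"
  have eq: "aval w ?s f = aval w s f" if "f \<in> set es" for f
    using Cons.prems that by (intro aval_input_expr_cong) auto
  have 1: "exec qp w (Store a (Reg 4) e) s (1 + acost e + 1) [] ?s"
    using exec.Store[of qp w a "Reg 4" e s] by simp
  have "exec qp w (store_all (Suc a) es) ?s ((\<Sum>e\<leftarrow>es. acost e + 2) + 1) []
    (?s\<lparr>arr := \<lambda>b x. if Suc a \<le> b \<and> b < Suc a + length es \<and> x = reg ?s 4
       then aval w ?s (es ! (b - Suc a)) else arr ?s b x\<rparr>)" (is "exec _ _ _ _ _ _ ?s'")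
    by (rule Cons.IH) (use Cons.prems in auto)
  note Seq[OF 1 this]
  moreover have "?s' = s\<lparr>arr := \<lambda>b x. if a \<le> b \<and> b < a + length (e # es) \<and> x = reg s 4
       then aval w s ((e # es) ! (b - a)) else arr s b x\<rparr>"
    by (rule store.equality) (auto simp: fun_eq_iff nth_Cons' eq)
  ultimately show ?case by (simp add: algebra_simps)
qed

lemma exec_Assign:
  assumes "aval w s e = v" "t = acost e + 1"
  shows "exec qp w (Assign r e) s t [] (s\<lparr>reg := (reg s)(r := v)\<rparr>)"
  using exec.Assign[of qp w r e s] assms by simp

lemma exec_Query:
  assumes "aval w s e = d" "v = of_bool (qp d (arr s a) (arr s b) (arr s c))" "t = acost e + 1"
  shows "exec qp w (Query r e a b c) s t [d] (s\<lparr>reg := (reg s)(r := v)\<rparr>)"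
  using exec.Query[of qp w r e a b c s] assms by simp

text \<open>The invariant is given as the explicit sequence \<open>st\<close> of stores, which fixes
  the number of iterations as well.\<close>

lemma exec_while_count:
  assumes "\<And>k. k < N \<Longrightarrow> aval w (st k) e \<noteq> 0" "aval w (st N) e = 0"
    and "\<And>k. k < N \<Longrightarrow> \<exists>t\<le>T. exec qp w c (st k) t [] (st (Suc k))"
  shows "\<exists>t\<le>N * (T + acost e + 1) + acost e + 1. exec qp w (While e c) (st 0) t [] (st N)"
  using assms
proof (induction N arbitrary: st)
  case 0
  then show ?case using exec.WhileFalse[of w "st 0" e qp c] by auto
next
  case (Suc N)
  obtain t where t: "t \<le> T" "exec qp w c (st 0) t [] (st (Suc 0))"
    using Suc.prems(3)[of 0] by auto
  obtain t' where t': "t' \<le> N * (T + acost e + 1) + acost e + 1"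
    "exec qp w (While e c) (st (Suc 0)) t' [] (st (Suc N))"
    using Suc.IH[of "\<lambda>k. st (Suc k)"] Suc.prems by auto
  have "exec qp w (While e c) (st 0) (acost e + 1 + t + t') ([] @ []) (st (Suc N))"
    using WhileTrue[OF _ t(2) t'(2)] Suc.prems(1)[of 0] by simp
  then show ?case using t(1) t'(1) by (intro exI[of _ "acost e + 1 + t + t'"]) simp
qed

text \<open>Registers: 0 order \<open>n\<close> and finally the verdict, 1 row, 2 column, 3 dimension \<open>2n\<close>,
  4 loop counter, 5 conjunction of the checks, 6 and 7 answers to the queries.\<close>

definition loop_body :: "aexp list \<Rightarrow> aexp \<Rightarrow> com" where
  "loop_body es ef =
     Seq (store_all 9 es)
     (Seq (Assign 5 (Mul (Reg 5) (Less (Const 0) ef)))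
     (Seq (Assign 4 (Add (Reg 4) (Const 1)))
     (Seq (Assign 2 (Add (Reg 2) (Const 1)))
       (Cond (Less (Reg 2) (Reg 3)) Skip
         (Seq (Assign 2 (Const 0)) (Assign 1 (Add (Reg 1) (Const 1))))))))"

definition matrix_check :: "aexp list \<Rightarrow> aexp \<Rightarrow> com" where
  "matrix_check es ef =
     Seq (Assign 3 (Mul (Const 2) (Reg 0)))
     (Seq (Assign 5 (Const 1))
     (Seq (While (Less (Reg 4) (Mul (Reg 3) (Reg 3))) (loop_body es ef))
     (Seq (Query 6 (Reg 3) 9 10 11)
     (Seq (Query 7 (Reg 3) 12 13 14)
       (Assign 0 (Mul (Reg 5) (Mul (Reg 6) (Reg 7))))))))"

text \<open>All that an \<open>input_expr\<close> can see while cell \<open>(i, j)\<close> is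
  treated. Matrix entries thereby become independent of the progress of the loop.\<close>

definition cell_store :: "nat \<Rightarrow> nat list list \<Rightarrow> nat \<Rightarrow> nat \<Rightarrow> store" where
  "cell_store n x i j = \<lparr> reg = (\<lambda>r. if r = 0 then n else if r = 1 then i else
     if r = 2 then j else if r = 3 then 2 * n else 0), arr = arr (initial_store n x) \<rparr>"

text \<open>Row-major layout. The default 0 agrees with the untouched part of a query array, so that
  the arrays built by the loop are equal to \<open>flatten\<close> as functions.\<close>

definition flatten :: "nat \<Rightarrow> (nat \<Rightarrow> nat \<Rightarrow> nat) \<Rightarrow> nat \<Rightarrow> nat" where
  "flatten d f x = (if x < d * d then f (x div d) (x mod d) else 0)"

text \<open>The loop invariant: the exact store after \<open>k\<close> cells in row-major
  order.\<close>

definition loop_store :: "nat \<Rightarrow> nat \<Rightarrow> nat list list \<Rightarrow> aexp list \<Rightarrow> aexp \<Rightarrow> nat \<Rightarrow> store" where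
  "loop_store w n x es ef k =
     \<lparr> reg = (\<lambda>r. if r = 0 then n else if r = 1 then k div (2 * n) else
         if r = 2 then k mod (2 * n) else if r = 3 then 2 * n else if r = 4 then k else
         if r = 5 then
           of_bool (\<forall>y<k. aval w (cell_store n x (y div (2 * n)) (y mod (2 * n))) ef \<noteq> 0)
         else 0),
       arr = (\<lambda>a y. if 9 \<le> a \<and> a < 9 + length es then
           (if y < k then aval w (cell_store n x (y div (2 * n)) (y mod (2 * n))) (es ! (a - 9))
            else 0)
         else arr (initial_store n x) a y) \<rparr>"

lemma aval_loop_store:
  assumes "input_expr e"
  shows "aval w (loop_store w n x es ef k) e =
    aval w (cell_store n x (k div (2 * n)) (k mod (2 * n))) e"
  using assms by (intro aval_input_expr_cong) (auto simp: loop_store_def cell_store_def)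

lemma mult_add_less:
  fixes i j m d :: nat
  assumes "i < m" "j < d"
  shows "i * d + j < m * d"
proof -
  have "i * d + j < Suc i * d" using assms(2) by simp
  also have "\<dots> \<le> m * d" using assms(1) by (intro mult_le_mono1) simp
  finally show ?thesis .
qed

text \<open>Expressions have no division, so row and column are kept as counters; these facts show
  that the counters follow quotient and remainder.\<close>

lemma div_mod_Suc:
  fixes d k :: nat
  assumes "0 < d"
  shows "Suc (k mod d) < d \<Longrightarrow> Suc k div d = k div d \<and> Suc k mod d = Suc (k mod d)"
    and "\<not> Suc (k mod d) < d \<Longrightarrow> Suc k div d = Suc (k div d) \<and> Suc k mod d = 0"
proof -
  have "k mod d < d" using assms by simp
  then show "Suc (k mod d) < d \<Longrightarrow> Suc k div d = k div d \<and> Suc k mod d = Suc (k mod d)"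
    "\<not> Suc (k mod d) < d \<Longrightarrow> Suc k div d = Suc (k div d) \<and> Suc k mod d = 0"
    by (auto simp: div_Suc mod_Suc)
qed

text \<open>The fixed instructions cost at most \<open>1 + 5 + 4 + 4 + 15\<close>, which 30
  covers.\<close>

definition body_time :: "aexp list \<Rightarrow> aexp \<Rightarrow> nat" where
  "body_time es ef = (\<Sum>e\<leftarrow>es. acost e + 2) + acost ef + 30"

text \<open>The bound on \<open>4 * n * n\<close>, the number of cells, keeps the three counters
  from wrapping around.\<close>

lemma exec_loop_body:
  assumes w: "4 * n * n < 2 ^ w" and k: "k < 2 * n * (2 * n)"
    and es: "\<forall>e\<in>set (ef # es). input_expr e"
  shows "\<exists>t\<le>body_time es ef. exec qp w (loop_body es ef)
    (loop_store w n x es ef k) t [] (loop_store w n x es ef (Suc k))"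
proof -
  let ?d = "2 * n" and ?s = "loop_store w n x es ef"
  have d: "0 < ?d" using k by (cases n) auto
  have d_le: "?d \<le> 4 * n * n" using d by (cases n) auto
  have small: "Suc k < 2 ^ w" "Suc (k mod ?d) < 2 ^ w"
    "k div ?d < ?d" "Suc (k div ?d) < 2 ^ w"
  proof -
    show "Suc k < 2 ^ w" using w k by simp
    have "k mod ?d < ?d" using d by simp
    then show "Suc (k mod ?d) < 2 ^ w" using w d_le by linarith
    show 1: "k div ?d < ?d" using k by (simp add: less_mult_imp_div_less)
    show "Suc (k div ?d) < 2 ^ w" using w d_le 1 by linarith
  qed
  have "1 < (2::nat) ^ w" using small by linarith
  then have 2: "1 < (2::nat) ^ w" "0 < w" by (cases w; simp)+
  let ?s1 = "(?s k)\<lparr>arr := \<lambda>b y. if 9 \<le> b \<and> b < 9 + length es \<and> y = reg (?s k) 4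
       then aval w (?s k) (es ! (b - 9)) else arr (?s k) b y\<rparr>"
  have e1: "exec qp w (store_all 9 es) (?s k) ((\<Sum>e\<leftarrow>es. acost e + 2) + 1) [] ?s1"
    by (rule exec_store_all) (use es in auto)
  have arr1: "arr ?s1 = arr (?s (Suc k))"
  proof (intro ext)
    fix b y
    show "arr ?s1 b y = arr (?s (Suc k)) b y"
    proof (cases "9 \<le> b \<and> b < 9 + length es \<and> y = k")
      case True
      then have "input_expr (es ! (b - 9))" using es by auto
      then show ?thesis using True by (simp add: aval_loop_store) (simp add: loop_store_def)
    next
      case False
      then show ?thesis by (auto simp: loop_store_def less_Suc_eq)
    qed
  qed
  have ef: "aval w ?s1 ef = aval w (cell_store n x (k div ?d) (k mod ?d)) ef"
    using es by (intro aval_input_expr_cong) (auto simp: loop_store_def cell_store_def)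
  let ?s2 = "?s1\<lparr>reg := (reg ?s1)(5 := reg (?s (Suc k)) 5)\<rparr>"
  have "aval w ?s1 (Mul (Reg 5) (Less (Const 0) ef)) = reg (?s (Suc k)) 5"
    using 2 by (auto simp: ef) (auto simp: loop_store_def less_Suc_eq)
  then have e2: "exec qp w (Assign 5 (Mul (Reg 5) (Less (Const 0) ef))) ?s1 (acost ef + 5) [] ?s2"
    by (rule exec_Assign) simp
  let ?s3 = "?s2\<lparr>reg := (reg ?s2)(4 := Suc k)\<rparr>"
  have e3: "exec qp w (Assign 4 (Add (Reg 4) (Const 1))) ?s2 4 [] ?s3"
    by (rule exec_Assign) (use small 2 in \<open>simp_all add: loop_store_def\<close>)
  let ?s4 = "?s3\<lparr>reg := (reg ?s3)(2 := Suc (k mod ?d))\<rparr>"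
  have e4: "exec qp w (Assign 2 (Add (Reg 2) (Const 1))) ?s3 4 [] ?s4"
    by (rule exec_Assign) (use small 2 in \<open>simp_all add: loop_store_def\<close>)
  have e5: "\<exists>t\<le>15. exec qp w (Cond (Less (Reg 2) (Reg 3)) Skip
         (Seq (Assign 2 (Const 0)) (Assign 1 (Add (Reg 1) (Const 1))))) ?s4 t [] (?s (Suc k))"
  proof (cases "Suc (k mod ?d) < ?d")
    case True
    have eq: "?s4 = ?s (Suc k)"
      by (rule store.equality)
        (use div_mod_Suc(1)[OF d True] arr1 in \<open>auto simp: loop_store_def fun_eq_iff\<close>)
    have "exec qp w (Cond (Less (Reg 2) (Reg 3)) Skip
         (Seq (Assign 2 (Const 0)) (Assign 1 (Add (Reg 1) (Const 1))))) ?s4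
         (acost (Less (Reg 2) (Reg 3)) + 1 + 1) [] ?s4"
      by (rule CondTrue[OF _ Skip]) (use True in \<open>simp add: loop_store_def\<close>)
    then show ?thesis unfolding eq by (intro exI[of _ "acost (Less (Reg 2) (Reg 3)) + 1 + 1"]) simp
  next
    case False
    let ?s5 = "?s4\<lparr>reg := (reg ?s4)(2 := 0)\<rparr>"
    have 5: "exec qp w (Assign 2 (Const 0)) ?s4 2 [] ?s5"
      by (rule exec_Assign) simp_all
    have "exec qp w (Assign 1 (Add (Reg 1) (Const 1))) ?s5 4 []
       (?s5\<lparr>reg := (reg ?s5)(1 := Suc (k div ?d))\<rparr>)"
      by (rule exec_Assign) (use small 2 in \<open>simp_all add: loop_store_def\<close>)
    moreover have "?s5\<lparr>reg := (reg ?s5)(1 := Suc (k div ?d))\<rparr> = ?s (Suc k)"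
      by (rule store.equality)
        (use div_mod_Suc(2)[OF d False] arr1 in \<open>auto simp: loop_store_def fun_eq_iff\<close>)
    ultimately have 6: "exec qp w (Assign 1 (Add (Reg 1) (Const 1))) ?s5 4 [] (?s (Suc k))"
      by (simp only:)
    have "exec qp w (Cond (Less (Reg 2) (Reg 3)) Skip
         (Seq (Assign 2 (Const 0)) (Assign 1 (Add (Reg 1) (Const 1))))) ?s4
         (acost (Less (Reg 2) (Reg 3)) + 1 + (2 + 4)) ([] @ []) (?s (Suc k))"
      by (rule CondFalse[OF _ Seq[OF 5 6]]) (use False in \<open>simp add: loop_store_def\<close>)
    then show ?thesis
      by (intro exI[of _ "acost (Less (Reg 2) (Reg 3)) + 1 + (2 + 4)"]) simp
  qed
  then obtain t where t: "t \<le> 15" and e5: "exec qp w (Cond (Less (Reg 2) (Reg 3)) Skip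
         (Seq (Assign 2 (Const 0)) (Assign 1 (Add (Reg 1) (Const 1))))) ?s4 t [] (?s (Suc k))"
    by blast
  have "exec qp w (loop_body es ef) (?s k)
      ((\<Sum>e\<leftarrow>es. acost e + 2) + 1 + (acost ef + 5 + (4 + (4 + t)))) ([] @ [] @ [] @ [] @ [])
      (?s (Suc k))"
    unfolding loop_body_def by (rule Seq[OF e1 Seq[OF e2 Seq[OF e3 Seq[OF e4 e5]]]])
  then show ?thesis
    using t by (intro exI[of _ "(\<Sum>e\<leftarrow>es. acost e + 2) + 1 + (acost ef + 5 + (4 + (4 + t)))"])
      (simp add: body_time_def)
qed

text \<open>There are \<open>4 * n * n\<close> passes, with 6 for each loop test; 30 covers the last
  test and the instructions outside the loop.\<close>

definition check_time :: "aexp list \<Rightarrow> aexp \<Rightarrow> nat \<Rightarrow> nat" where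
  "check_time es ef n = 4 * n * n * (body_time es ef + 6) + 30"

lemma exec_matrix_check:
  assumes w: "4 * n * n < 2 ^ w" "2 \<le> w" and x: "length x \<le> 9"
    and es: "\<forall>e\<in>set (ef # es). input_expr e" "length es = 6"
  defines "cells e \<equiv> flatten (2 * n) (\<lambda>i j. aval w (cell_store n x i j) e)"
  shows "\<exists>t qs s'. exec qp w (matrix_check es ef) (initial_store n x) t qs s' \<and>
    t \<le> check_time es ef n \<and> qs = [2 * n, 2 * n] \<and>
    (reg s' 0 = 1 \<longleftrightarrow>
      (\<forall>i<2 * n. \<forall>j<2 * n. aval w (cell_store n x i j) ef \<noteq> 0) \<and>
      qp (2 * n) (cells (es ! 0)) (cells (es ! 1)) (cells (es ! 2)) \<and>
      qp (2 * n) (cells (es ! 3)) (cells (es ! 4)) (cells (es ! 5)))"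
proof -
  let ?d = "2 * n" and ?s = "loop_store w n x es ef" and ?init = "initial_store n x"
  define N where "N = ?d * ?d"
  have 2: "(4::nat) \<le> 2 ^ w"
    using power_increasing[of 2 w "2::nat"] w(2) by simp
  have "?d \<le> 4 * n * n" by (cases n) auto
  then have dN: "?d < 2 ^ w" "N < 2 ^ w"
    using w(1) by (linarith, simp add: N_def mult.assoc)
  let ?s1 = "?init\<lparr>reg := (reg ?init)(3 := ?d)\<rparr>"
  have e1: "exec qp w (Assign 3 (Mul (Const 2) (Reg 0))) ?init 4 [] ?s1"
    by (rule exec_Assign) (use dN 2 w(2) in \<open>simp_all add: initial_store_def\<close>)
  have "exec qp w (Assign 5 (Const 1)) ?s1 2 [] (?s1\<lparr>reg := (reg ?s1)(5 := 1)\<rparr>)"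
    by (rule exec_Assign) (use 2 w(2) in simp_all)
  \<comment> \<open>With at most nine input arrays, those from 9 on are still zero, as
    \<open>loop_store\<close> with counter 0 requires.\<close>
  moreover have "?s1\<lparr>reg := (reg ?s1)(5 := 1)\<rparr> = ?s 0"
    by (rule store.equality) (use x in \<open>auto simp: loop_store_def initial_store_def fun_eq_iff\<close>)
  ultimately have e2: "exec qp w (Assign 5 (Const 1)) ?s1 2 [] (?s 0)" by (simp only:)
  let ?e = "Less (Reg 4) (Mul (Reg 3) (Reg 3))"
  have val: "aval w (?s k) ?e = of_bool (k < N)" for k
    using dN by (simp add: loop_store_def flip: N_def)
  have "\<exists>t\<le>N * (body_time es ef + acost ?e + 1) + acost ?e + 1.
      exec qp w (While ?e (loop_body es ef)) (?s 0) t [] (?s N)"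
    by (rule exec_while_count) (use val exec_loop_body[OF w(1) _ es(1)] in \<open>auto simp: N_def\<close>)
  then obtain t where t: "t \<le> N * (body_time es ef + acost ?e + 1) + acost ?e + 1"
    and e3: "exec qp w (While ?e (loop_body es ef)) (?s 0) t [] (?s N)"
    by blast
  have arr: "arr (?s N) (9 + a) = cells (es ! a)" if "a < 6" for a
    by (rule ext) (use that es(2) in \<open>simp add: loop_store_def cells_def flatten_def N_def\<close>)
  have q: "arr (?s N) 9 = cells (es ! 0)" "arr (?s N) 10 = cells (es ! 1)"
    "arr (?s N) 11 = cells (es ! 2)" "arr (?s N) 12 = cells (es ! 3)"
    "arr (?s N) 13 = cells (es ! 4)" "arr (?s N) 14 = cells (es ! 5)"
    using arr[of 0] arr[of 1] arr[of 2] arr[of 3] arr[of 4] arr[of 5] by simp_all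
  define b :: nat where "b = of_bool (qp ?d (cells (es ! 0)) (cells (es ! 1)) (cells (es ! 2)))"
  define b' :: nat where "b' = of_bool (qp ?d (cells (es ! 3)) (cells (es ! 4)) (cells (es ! 5)))"
  let ?s4 = "(?s N)\<lparr>reg := (reg (?s N))(6 := b)\<rparr>"
  have rd: "reg (?s N) 3 = ?d" by (simp add: loop_store_def)
  have e4: "exec qp w (Query 6 (Reg 3) 9 10 11) (?s N) 2 [?d] ?s4"
    by (rule exec_Query) (simp_all add: q rd b_def)
  let ?s5 = "?s4\<lparr>reg := (reg ?s4)(7 := b')\<rparr>"
  have e5: "exec qp w (Query 7 (Reg 3) 12 13 14) ?s4 2 [?d] ?s5"
    by (rule exec_Query) (simp_all add: q rd b'_def)
  let ?e6 = "Mul (Reg 5) (Mul (Reg 6) (Reg 7))"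
  note e6 = exec.Assign[of qp w 0 ?e6 ?s5]
  have run: "exec qp w (matrix_check es ef) ?init
      (4 + (2 + (t + (2 + (2 + (acost ?e6 + 1)))))) ([] @ [] @ [] @ [?d] @ [?d] @ [])
      (?s5\<lparr>reg := (reg ?s5)(0 := aval w ?s5 ?e6)\<rparr>)"
    unfolding matrix_check_def by (rule Seq[OF e1 Seq[OF e2 Seq[OF e3 Seq[OF e4 Seq[OF e5 e6]]]]])
  have time: "4 + (2 + (t + (2 + (2 + (acost ?e6 + 1))))) \<le> check_time es ef n"
    using t by (simp add: check_time_def N_def algebra_simps)
  have all: "(\<forall>y<N. aval w (cell_store n x (y div ?d) (y mod ?d)) ef \<noteq> 0) \<longleftrightarrow>
      (\<forall>i<?d. \<forall>j<?d. aval w (cell_store n x i j) ef \<noteq> 0)" (is "?L \<longleftrightarrow> ?R")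
  proof
    assume L: ?L
    show ?R
    proof (intro allI impI)
      fix i j assume ij: "i < ?d" "j < ?d"
      have "i * ?d + j < N" using mult_add_less[OF ij] by (simp add: N_def)
      moreover have "(i * ?d + j) div ?d = i" "(i * ?d + j) mod ?d = j"
        using ij by auto
      ultimately show "aval w (cell_store n x i j) ef \<noteq> 0" using L by metis
    qed
  next
    assume R: ?R
    show ?L
    proof (intro allI impI)
      fix y assume y: "y < N"
      then have "y div ?d < ?d" by (simp add: N_def less_mult_imp_div_less)
      moreover have "y mod ?d < ?d" using y by (cases "n = 0") (auto simp: N_def)
      ultimately show "aval w (cell_store n x (y div ?d) (y mod ?d)) ef \<noteq> 0"
        using R by blast
    qed
  qed
  define c where "c = reg (?s N) 5"
  have c: "c = of_bool (\<forall>i<?d. \<forall>j<?d. aval w (cell_store n x i j) ef \<noteq> 0)"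
    unfolding c_def all[symmetric] by (simp add: loop_store_def)
  have "aval w ?s5 ?e6 = (c * (b * b' mod 2 ^ w)) mod 2 ^ w"
    by (simp add: c_def)
  also have "\<dots> = of_bool ((\<forall>i<?d. \<forall>j<?d. aval w (cell_store n x i j) ef \<noteq> 0) \<and>
      qp ?d (cells (es ! 0)) (cells (es ! 1)) (cells (es ! 2)) \<and>
      qp ?d (cells (es ! 3)) (cells (es ! 4)) (cells (es ! 5)))"
    using w(2) unfolding c b_def b'_def by (simp only: of_bool_conj[symmetric]) simp
  finally have res: "aval w ?s5 ?e6 = of_bool ((\<forall>i<?d. \<forall>j<?d. aval w (cell_store n x i j) ef \<noteq> 0) \<and>
      qp ?d (cells (es ! 0)) (cells (es ! 1)) (cells (es ! 2)) \<and>
      qp ?d (cells (es ! 3)) (cells (es ! 4)) (cells (es ! 5)))" .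
  have fin: "reg (?s5\<lparr>reg := (reg ?s5)(0 := aval w ?s5 ?e6)\<rparr>) 0 = of_bool
      ((\<forall>i<?d. \<forall>j<?d. aval w (cell_store n x i j) ef \<noteq> 0) \<and>
      qp ?d (cells (es ! 0)) (cells (es ! 1)) (cells (es ! 2)) \<and>
      qp ?d (cells (es ! 3)) (cells (es ! 4)) (cells (es ! 5)))"
    unfolding res by simp
  show ?thesis
    by (rule exI, rule exI, rule exI, rule conjI, rule run, rule conjI, rule time)
      (simp only: fin, simp)
qed

text \<open>Determinism makes the run found above the only one. The resulting equivalence also shows
  when the program rejects, on which the soundness of certificates depends.\<close>

lemma decides_within_matrix_check:
  assumes "4 * n * n < 2 ^ w" "2 \<le> w" "length x \<le> 9"
    "\<forall>e\<in>set (ef # es). input_expr e" "length es = 6"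
  defines "cells e \<equiv> flatten (2 * n) (\<lambda>i j. aval w (cell_store n x i j) e)"
  shows "decides_within qp w (matrix_check es ef) n x (check_time es ef n) 2 (2 * n) ans \<longleftrightarrow>
    (ans \<longleftrightarrow> (\<forall>i<2 * n. \<forall>j<2 * n. aval w (cell_store n x i j) ef \<noteq> 0) \<and>
      qp (2 * n) (cells (es ! 0)) (cells (es ! 1)) (cells (es ! 2)) \<and>
      qp (2 * n) (cells (es ! 3)) (cells (es ! 4)) (cells (es ! 5)))" (is "_ \<longleftrightarrow> (ans \<longleftrightarrow> ?R)")
proof -
  obtain t s' where *: "exec qp w (matrix_check es ef) (initial_store n x) t [2 * n, 2 * n] s'"
    "t \<le> check_time es ef n" "reg s' 0 = 1 \<longleftrightarrow> ?R"
    using exec_matrix_check[OF assms(1-5), of qp] unfolding cells_def by blast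
  show ?thesis
  proof
    assume "decides_within qp w (matrix_check es ef) n x (check_time es ef n) 2 (2 * n) ans"
    then obtain t' qs s'' where "exec qp w (matrix_check es ef) (initial_store n x) t' qs s''"
      "ans \<longleftrightarrow> reg s'' 0 = 1"
      unfolding decides_within_def by blast
    with exec_deterministic[OF *(1)] *(3) show "ans \<longleftrightarrow> ?R" by blast
  next
    assume "ans \<longleftrightarrow> ?R"
    then show "decides_within qp w (matrix_check es ef) n x (check_time es ef n) 2 (2 * n) ans"
      unfolding decides_within_def
      by (intro exI[of _ t] exI[of _ "[2 * n, 2 * n]"] exI[of _ s']) (use * in simp)
  qed
qed

section \<open>Disjunctions as block matrix products\<close>

lemma flatten_entry: "i < d \<Longrightarrow> j < d \<Longrightarrow> flatten d f (i * d + j) = f i j"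
  using mult_add_less[of i d j d] by (simp add: flatten_def)

lemma flatten_cong:
  assumes "\<And>i j. i < d \<Longrightarrow> j < d \<Longrightarrow> f i j = g i j"
  shows "flatten d f = flatten d g"
proof
  fix y
  have "y div d < d \<and> y mod d < d" if "y < d * d"
    using that by (cases "d = 0") (simp_all add: less_mult_imp_div_less)
  then show "flatten d f y = flatten d g y"
    using assms by (simp add: flatten_def)
qed

lemma int_mpv_flatten:
  "int_mpv d (flatten d a) (flatten d b) (flatten d c) \<longleftrightarrow>
    (\<forall>i<d. \<forall>j<d. c i j = (\<Sum>k<d. a i k * b k j))"
proof -
  have "int_mat_of d (flatten d f) $$ (i, j) = int (f i j)" if "i < d" "j < d" for f i j
    using that by (simp add: int_mat_of_def flatten_entry)
  moreover have "dim_row (int_mat_of d f) = d" "dim_col (int_mat_of d f) = d" for f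
    by (simp_all add: int_mat_of_def)
  ultimately have "int_mpv d (flatten d a) (flatten d b) (flatten d c) \<longleftrightarrow>
      (\<forall>i<d. \<forall>j<d. int (c i j) = (\<Sum>k\<in>{0..<d}. int (a i k) * int (b k j)))"
    by (simp add: int_mpv_def mat_eq_iff scalar_prod_def)
  also have "\<dots> \<longleftrightarrow> (\<forall>i<d. \<forall>j<d. int (c i j) = int (\<Sum>k<d. a i k * b k j))"
    by (simp add: atLeast0LessThan)
  finally show ?thesis by (simp only: of_nat_eq_iff)
qed

text \<open>The disjunction is phrased as a non-zero sum of naturals, so that one computation of a
  block product serves both kinds of query.\<close>

lemma bool_mpv_flatten:
  "bool_mpv d (flatten d a) (flatten d b) (flatten d c) \<longleftrightarrow>
    (\<forall>i<d. \<forall>j<d. c i j \<noteq> 0 \<longleftrightarrow> (\<Sum>k<d. a i k * b k j) \<noteq> 0)"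
proof -
  have "bool_mat_of d (flatten d f) $$ (i, j) \<longleftrightarrow> f i j \<noteq> 0" if "i < d" "j < d" for f i j
    using that by (simp add: bool_mat_of_def flatten_entry)
  moreover have "dim_row (bool_mat_of d f) = d" "dim_col (bool_mat_of d f) = d" for f
    by (simp_all add: bool_mat_of_def)
  ultimately have "bool_mpv d (flatten d a) (flatten d b) (flatten d c) \<longleftrightarrow>
      (\<forall>i<d. \<forall>j<d. c i j \<noteq> 0 \<longleftrightarrow> (\<exists>k<d. a i k \<noteq> 0 \<and> b k j \<noteq> 0))"
    by (simp add: bool_mpv_def mat_eq_iff bool_mat_mult_def cong: conj_cong)
  also have "\<dots> \<longleftrightarrow> (\<forall>i<d. \<forall>j<d. c i j \<noteq> 0 \<longleftrightarrow> (\<Sum>k<d. a i k * b k j) \<noteq> 0)"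
    by auto
  finally show ?thesis .
qed

text \<open>The disjunction with \<open>f\<close> becomes part of the product:
  $(e \mid 1) \cdot (x \mid f^T)^T = e x^T + f$, all padded to dimension \<open>2n\<close>.\<close>

definition block_left :: "nat \<Rightarrow> (nat \<Rightarrow> nat \<Rightarrow> nat) \<Rightarrow> nat \<Rightarrow> nat \<Rightarrow> nat" where
  "block_left n e i j = (if i < n then if j < n then e i j else of_bool (j = i + n) else 0)"

definition block_right ::
    "nat \<Rightarrow> (nat \<Rightarrow> nat \<Rightarrow> nat) \<Rightarrow> (nat \<Rightarrow> nat \<Rightarrow> nat) \<Rightarrow> nat \<Rightarrow> nat \<Rightarrow> nat" where
  "block_right n x f i j = (if j < n then if i < n then x j i else f (i - n) j else 0)"

definition block_out :: "nat \<Rightarrow> (nat \<Rightarrow> nat \<Rightarrow> nat) \<Rightarrow> nat \<Rightarrow> nat \<Rightarrow> nat" where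
  "block_out n c i j = (if i < n \<and> j < n then c i j else 0)"

text \<open>Split the sum at \<open>n\<close>: the first half is the product with the transpose of
  \<open>x\<close>, and in the second the identity block picks out \<open>f i j\<close>. Outside the
  upper left block one factor always vanishes.\<close>

lemma block_product:
  "(\<Sum>k<2 * n. block_left n e i k * block_right n x f k j) =
    block_out n (\<lambda>i j. (\<Sum>k<n. e i k * x j k) + f i j) i j"
proof (cases "i < n \<and> j < n")
  case True
  have split: "(\<Sum>k<n + m. g k) = (\<Sum>k<n. g k) + (\<Sum>k<m. g (n + k))" for g :: "nat \<Rightarrow> nat" and m
    by (induction m) simp_all
  have "(\<Sum>k<n. of_bool (n + k = i + n) * f k j) = (\<Sum>k<n. if k = i then f k j else 0)"
    by (intro sum.cong) auto
  also have "\<dots> = f i j" using True by simp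
  finally show ?thesis
    using True by (simp add: mult_2 split block_left_def block_right_def block_out_def)
next
  case False
  then show ?thesis by (auto simp: block_left_def block_right_def block_out_def)
qed

text \<open>\<open>R\<close> will be equality for integers and agreement on being non-zero for
  booleans; the padding contributes only \<open>R 0 0\<close>.\<close>

lemma block_out_eq_iff:
  "(\<forall>i<2 * n. \<forall>j<2 * n. R (block_out n c i j) (block_out n c' i j)) \<longleftrightarrow>
    (\<forall>i<n. \<forall>j<n. R (c i j) (c' i j))" if "R 0 0"
  using that by (auto simp: block_out_def)

lemma int_mpv_blocks:
  "int_mpv (2 * n) (flatten (2 * n) (block_left n e)) (flatten (2 * n) (block_right n x f))
      (flatten (2 * n) (block_out n c)) \<longleftrightarrow>
    (\<forall>i<n. \<forall>j<n. c i j = (\<Sum>k<n. e i k * x j k) + f i j)"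
  unfolding int_mpv_flatten block_product by (rule block_out_eq_iff) simp

lemma bool_mpv_blocks:
  "bool_mpv (2 * n) (flatten (2 * n) (block_left n e)) (flatten (2 * n) (block_right n x f))
      (flatten (2 * n) (block_out n c)) \<longleftrightarrow>
    (\<forall>i<n. \<forall>j<n. c i j \<noteq> 0 \<longleftrightarrow> (\<Sum>k<n. e i k * x j k) + f i j \<noteq> 0)"
  unfolding bool_mpv_flatten block_product by (rule block_out_eq_iff) simp

section \<open>Expressions for matrix entries\<close>

text \<open>A matrix is a function of two index expressions, so it can also be read transposed or at
  a shifted row. The word bound ensures that multiplying an entry by a 0/1 test does not reduce it
  modulo \<open>2 ^ w\<close>.\<close>

definition denotes ::
    "nat \<Rightarrow> nat \<Rightarrow> nat list list \<Rightarrow> (aexp \<Rightarrow> aexp \<Rightarrow> aexp) \<Rightarrow> (nat \<Rightarrow> nat \<Rightarrow> nat) \<Rightarrow> bool" where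
  "denotes w n x e v \<longleftrightarrow>
     (\<forall>i<n. \<forall>j<n. v i j < 2 ^ w) \<and>
     (\<forall>p q. input_expr p \<and> input_expr q \<longrightarrow> input_expr (e p q)) \<and>
     (\<forall>s p q. reg s 0 = n \<and> arr s = arr (initial_store n x) \<and> aval w s p < n \<and> aval w s q < n \<longrightarrow>
        aval w s (e p q) = v (aval w s p) (aval w s q))"

lemma denotesD:
  assumes "denotes w n x e v"
  shows "i < n \<Longrightarrow> j < n \<Longrightarrow> v i j < 2 ^ w"
    and "input_expr p \<Longrightarrow> input_expr q \<Longrightarrow> input_expr (e p q)"
    and "reg s 0 = n \<Longrightarrow> arr s = arr (initial_store n x) \<Longrightarrow> aval w s p < n \<Longrightarrow> aval w s q < n \<Longrightarrow>
        aval w s (e p q) = v (aval w s p) (aval w s q)"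
  using assms unfolding denotes_def by blast+

abbreviation (input) holds ::
    "nat \<Rightarrow> nat \<Rightarrow> nat list list \<Rightarrow> (aexp \<Rightarrow> aexp \<Rightarrow> aexp) \<Rightarrow> (nat \<Rightarrow> nat \<Rightarrow> bool) \<Rightarrow> bool" where
  "holds w n x e P \<equiv> denotes w n x e (\<lambda>i j. of_bool (P i j))"

text \<open>Expressions have no conditional, so here and below cases are selected by 0/1 factors;
  whatever is read out of range is multiplied by 0.\<close>

definition left_expr :: "(aexp \<Rightarrow> aexp \<Rightarrow> aexp) \<Rightarrow> aexp" where
  "left_expr e = Mul (Less (Reg 1) (Reg 0))
     (Add (Mul (Less (Reg 2) (Reg 0)) (e (Reg 1) (Reg 2))) (Equal (Reg 2) (Add (Reg 1) (Reg 0))))"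

definition right_expr :: "(aexp \<Rightarrow> aexp \<Rightarrow> aexp) \<Rightarrow> (aexp \<Rightarrow> aexp \<Rightarrow> aexp) \<Rightarrow> aexp" where
  "right_expr x f = Mul (Less (Reg 2) (Reg 0))
     (Add (Mul (Less (Reg 1) (Reg 0)) (x (Reg 2) (Reg 1)))
       (Mul (Equal (Const 0) (Less (Reg 1) (Reg 0))) (f (Sub (Reg 1) (Reg 0)) (Reg 2))))"

definition out_expr :: "(aexp \<Rightarrow> aexp \<Rightarrow> aexp) \<Rightarrow> aexp" where
  "out_expr c = Mul (Mul (Less (Reg 1) (Reg 0)) (Less (Reg 2) (Reg 0))) (c (Reg 1) (Reg 2))"

text \<open>The implication from "inside the block" to \<open>c\<close>, written as the negation of
  \<open>c < inside\<close>; padding cells pass whatever is read there.\<close>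

definition flag_expr :: "(aexp \<Rightarrow> aexp \<Rightarrow> aexp) \<Rightarrow> aexp" where
  "flag_expr c = Equal (Const 0)
     (Less (c (Reg 1) (Reg 2)) (Mul (Less (Reg 1) (Reg 0)) (Less (Reg 2) (Reg 0))))"

lemma input_expr_blocks:
  assumes "denotes w n x e v"
  shows "input_expr (left_expr e)" "input_expr (out_expr e)" "input_expr (flag_expr e)"
    and "denotes w n x f u \<Longrightarrow> input_expr (right_expr e f)"
  using denotesD(2)[OF assms] denotesD(2)[of w n x f u]
  by (simp_all add: left_expr_def out_expr_def flag_expr_def right_expr_def)

lemma cell_store_simps:
  "reg (cell_store n x i j) 0 = n" "reg (cell_store n x i j) 1 = i"
  "reg (cell_store n x i j) (Suc 0) = i"
  "reg (cell_store n x i j) 2 = j" "arr (cell_store n x i j) = arr (initial_store n x)"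
  by (simp_all add: cell_store_def)

definition entry :: "nat \<Rightarrow> aexp \<Rightarrow> aexp \<Rightarrow> aexp" where
  "entry a p q = Load a (Add (Mul p (Reg 0)) q)"

text \<open>Skips one block of \<open>n * n\<close> words: \<open>config_bits\<close> puts Bob's
  matrix after Alice's, and a certificate holds two products in the same way.\<close>

definition entry2 :: "nat \<Rightarrow> aexp \<Rightarrow> aexp \<Rightarrow> aexp" where
  "entry2 a p q = Load a (Add (Mul (Reg 0) (Reg 0)) (Add (Mul p (Reg 0)) q))"

context
  fixes w n :: nat and x :: "nat list list"
  assumes word: "4 * n * n < 2 ^ w" "2 \<le> w"
begin

text \<open>Keeps the comparison with \<open>i + n\<close> in \<open>left_expr\<close> free of
  wrap-around.\<close>

lemma small_index: "i < 2 * n \<Longrightarrow> i + n < 2 ^ w"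
proof -
  assume i: "i < 2 * n"
  show ?thesis
  proof (cases "n = 1")
    case True
    then show ?thesis using i word by simp
  next
    case False
    then have "2 \<le> n" using i by simp
    then have "4 * 2 * n \<le> 4 * n * n" by simp
    then show ?thesis using i word by linarith
  qed
qed

lemma word_gt_1: "1 < (2::nat) ^ w" "0 < w"
  using word(2) power_increasing[of 2 w "2::nat"] by simp_all

lemma aval_left_expr:
  assumes e: "denotes w n x e v" and "i < 2 * n" "j < 2 * n"
  shows "aval w (cell_store n x i j) (left_expr e) = block_left n v i j"
proof (cases "i < n \<and> j < n")
  case True
  then show ?thesis
    using denotesD(1)[OF e, of i j] denotesD(3)[OF e, of "cell_store n x i j" "Reg 1" "Reg 2"]
      small_index[OF assms(2)] word_gt_1
    by (simp add: left_expr_def block_left_def cell_store_simps)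
next
  case False
  then show ?thesis
    using small_index[OF assms(2)] word_gt_1
    by (auto simp: left_expr_def block_left_def cell_store_simps)
qed

lemma aval_right_expr:
  assumes e: "denotes w n x e v" and f: "denotes w n x f u" and "i < 2 * n" "j < 2 * n"
  shows "aval w (cell_store n x i j) (right_expr e f) = block_right n v u i j"
proof (cases "j < n")
  case True
  show ?thesis
  proof (cases "i < n")
    \<comment> \<open>For \<open>i < n\<close> the subtraction may wrap around and \<open>f\<close>
      is read at a meaningless place; the factor \<open>Equal (Const 0) ...\<close> is 0 and removes
      it.\<close>
    case True
    then show ?thesis
      using denotesD(1)[OF e, of j i] denotesD(3)[OF e, of "cell_store n x i j" "Reg 2" "Reg 1"]
        \<open>j < n\<close> word_gt_1
      by (simp add: right_expr_def block_right_def cell_store_simps)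
  next
    case False
    then have sub: "aval w (cell_store n x i j) (Sub (Reg 1) (Reg 0)) = i - n"
      using small_index[OF assms(3)]
      by (simp add: cell_store_simps flip: of_nat_diff)
    have "i - n < n" using False assms(3) by simp
    then show ?thesis
      using denotesD(1)[OF f, of "i - n" j] False
        denotesD(3)[OF f, of "cell_store n x i j" "Sub (Reg 1) (Reg 0)" "Reg 2"]
        \<open>j < n\<close> word_gt_1
      unfolding right_expr_def block_right_def
      by (simp add: sub cell_store_simps del: aval.simps(5) One_nat_def)
  qed
next
  case False
  then show ?thesis
    by (simp add: right_expr_def block_right_def cell_store_simps)
qed

lemma aval_out_expr:
  assumes c: "denotes w n x c v"
  shows "aval w (cell_store n x i j) (out_expr c) = block_out n v i j"
proof (cases "i < n \<and> j < n")
  case True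
  then show ?thesis
    using denotesD(1)[OF c, of i j] denotesD(3)[OF c, of "cell_store n x i j" "Reg 1" "Reg 2"]
      word_gt_1
    by (simp add: out_expr_def block_out_def cell_store_simps)
next
  case False
  then show ?thesis
    by (auto simp: out_expr_def block_out_def cell_store_simps)
qed

lemma aval_flag_expr:
  assumes c: "holds w n x c P"
  shows "aval w (cell_store n x i j) (flag_expr c) \<noteq> 0 \<longleftrightarrow> (i < n \<and> j < n \<longrightarrow> P i j)"
proof (cases "i < n \<and> j < n")
  case True
  then show ?thesis
    using denotesD(3)[OF c, of "cell_store n x i j" "Reg 1" "Reg 2"] word_gt_1
    by (simp add: flag_expr_def cell_store_simps)
next
  case False
  then show ?thesis
    by (auto simp: flag_expr_def cell_store_simps)
qed

text \<open>Stated for arbitrary words, so that counts from a certificate can be turned into bits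
  too.\<close>

lemma holds_neg: "denotes w n x e v \<Longrightarrow> holds w n x (\<lambda>p q. Equal (Const 0) (e p q)) (\<lambda>i j. v i j = 0)"
  using word_gt_1 by (auto simp: denotes_def of_bool_def)

lemma holds_pos: "denotes w n x e v \<Longrightarrow> holds w n x (\<lambda>p q. Less (Const 0) (e p q)) (\<lambda>i j. v i j \<noteq> 0)"
  using word_gt_1 by (auto simp: denotes_def of_bool_def)

lemma holds_eq:
  "denotes w n x e v \<Longrightarrow> denotes w n x f u \<Longrightarrow>
    holds w n x (\<lambda>p q. Equal (e p q) (f p q)) (\<lambda>i j. v i j = u i j)"
  using word_gt_1 by (auto simp: denotes_def of_bool_def)

lemma holds_conj:
  "holds w n x e P \<Longrightarrow> holds w n x f Q \<Longrightarrow>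
    holds w n x (\<lambda>p q. Mul (e p q) (f p q)) (\<lambda>i j. P i j \<and> Q i j)"
  using word_gt_1 by (auto simp: denotes_def)

lemma holds_False: "holds w n x (\<lambda>p q. Const 0) (\<lambda>i j. False)"
  using word_gt_1 by (auto simp: denotes_def)

lemma index_less:
  assumes "i < n" "j < n"
  shows "i * n + j < n * n" "n * n + i * n + j < 2 ^ w" "n < 2 ^ w"
proof -
  show 1: "i * n + j < n * n" by (rule mult_add_less[OF assms])
  then show "n * n + i * n + j < 2 ^ w" using word by simp
  show "n < 2 ^ w" using small_index[of 0] assms by simp
qed

lemma denotes_entry:
  assumes "a < 9" "\<And>i j. i < n \<Longrightarrow> j < n \<Longrightarrow> arr (initial_store n x) a (i * n + j) = v i j"
    "\<And>i j. i < n \<Longrightarrow> j < n \<Longrightarrow> v i j < 2 ^ w"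
  shows "denotes w n x (entry a) v"
  unfolding denotes_def
proof (intro conjI allI impI)
  fix s p q assume *: "reg s 0 = n \<and> arr s = arr (initial_store n x) \<and> aval w s p < n \<and> aval w s q < n"
  then have "aval w s p * n + aval w s q < 2 ^ w"
    using index_less[of "aval w s p" "aval w s q"] by simp
  moreover from this have "aval w s p * n < 2 ^ w" by simp
  ultimately show "aval w s (entry a p q) = v (aval w s p) (aval w s q)"
    using assms(2)[of "aval w s p" "aval w s q"] * by (simp add: entry_def)
qed (use assms in \<open>auto simp: entry_def\<close>)

lemma denotes_entry2:
  assumes "a < 9" "\<And>i j. i < n \<Longrightarrow> j < n \<Longrightarrow> arr (initial_store n x) a (n * n + (i * n + j)) = v i j"
    "\<And>i j. i < n \<Longrightarrow> j < n \<Longrightarrow> v i j < 2 ^ w"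
  shows "denotes w n x (entry2 a) v"
  unfolding denotes_def
proof (intro conjI allI impI)
  fix s p q assume *: "reg s 0 = n \<and> arr s = arr (initial_store n x) \<and> aval w s p < n \<and> aval w s q < n"
  then have "n * n + (aval w s p * n + aval w s q) < 2 ^ w"
    using index_less[of "aval w s p" "aval w s q"] by simp
  moreover from this have "n * n < 2 ^ w" "aval w s p * n + aval w s q < 2 ^ w"
    "aval w s p * n < 2 ^ w" by simp_all
  ultimately show "aval w s (entry2 a p q) = v (aval w s p) (aval w s q)"
    using assms(2)[of "aval w s p" "aval w s q"] * by (simp add: entry2_def)
qed (use assms in \<open>auto simp: entry2_def\<close>)

end

text \<open>The two queries stand for \<open>c0 = e0 * y0^T + f0\<close> and
  \<open>c1 = e1 * y1^T + f1\<close>; \<open>right_expr\<close> does the transposing.\<close>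

definition equation_prog ::
    "(aexp \<Rightarrow> aexp \<Rightarrow> aexp) \<Rightarrow> (aexp \<Rightarrow> aexp \<Rightarrow> aexp) \<Rightarrow> (aexp \<Rightarrow> aexp \<Rightarrow> aexp) \<Rightarrow>
     (aexp \<Rightarrow> aexp \<Rightarrow> aexp) \<Rightarrow> (aexp \<Rightarrow> aexp \<Rightarrow> aexp) \<Rightarrow> (aexp \<Rightarrow> aexp \<Rightarrow> aexp) \<Rightarrow>
     (aexp \<Rightarrow> aexp \<Rightarrow> aexp) \<Rightarrow> (aexp \<Rightarrow> aexp \<Rightarrow> aexp) \<Rightarrow> aexp list" where
  "equation_prog e0 y0 f0 c0 e1 y1 f1 c1 =
     [left_expr e0, right_expr y0 f0, out_expr c0, left_expr e1, right_expr y1 f1, out_expr c1]"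

text \<open>One square in \<open>(n + 2) ^ 4\<close> exceeds \<open>n * n\<close> and
  \<open>n + 1\<close>, the other supplies the factor 4. The bound \<open>4 * n * n\<close> serves
  counters and indices, \<open>n + 1\<close> the entries of certificates.\<close>

lemma word_bounds:
  fixes n w :: nat
  assumes "(n + 2) ^ 4 \<le> 2 ^ w"
  shows "4 * n * n < 2 ^ w" "2 \<le> w" "n + 1 < 2 ^ w"
proof -
  have "n * n < (n + 2) ^ 2" "4 \<le> (n + 2) ^ 2" "n + 1 < (n + 2) ^ 2"
    by (simp_all add: power2_eq_square)
  moreover have "(n + 2) ^ 4 = (n + 2) ^ 2 * (n + 2) ^ 2"
    by (simp flip: power_add)
  moreover have "4 * (n + 2) ^ 2 \<le> (n + 2) ^ 2 * (n + 2) ^ 2"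
    using calculation(2) by (rule mult_le_mono1)
  ultimately have *: "4 * (n * n) < 2 ^ w" "n + 1 < 2 ^ w" "16 \<le> (2::nat) ^ w"
    using assms by linarith+
  from *(1) show "4 * n * n < 2 ^ w" by (simp add: mult.assoc)
  from *(2) show "n + 1 < 2 ^ w" .
  show "2 \<le> w"
  proof (rule ccontr)
    assume "\<not> 2 \<le> w"
    then have "(2::nat) ^ w \<le> 2 ^ 1" by (intro power_increasing) auto
    with *(3) show False by simp
  qed
qed

lemma conj_all2:
  "(\<forall>i<n. \<forall>j<n. P i j) \<and> (\<forall>i<n. \<forall>j<n. Q i j) \<longleftrightarrow> (\<forall>i<n. \<forall>j<n::nat. P i j \<and> Q i j)"
  by blast

text \<open>The same program under both queries: the boolean one sees only whether a sum vanishes,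
  the integer one forces \<open>C0\<close> and \<open>C1\<close> to be the exact counts.\<close>

lemma decides_equation_prog:
  assumes w: "(n + 2) ^ 4 \<le> 2 ^ w" and x: "length x \<le> 9"
    and e0: "holds w n x e0 E0" and y0: "holds w n x y0 Y0"
    and f0: "holds w n x f0 F0" and c0: "denotes w n x c0 C0"
    and e1: "holds w n x e1 E1" and y1: "holds w n x y1 Y1"
    and f1: "holds w n x f1 F1" and c1: "denotes w n x c1 C1" and chk: "holds w n x chk K"
  defines "run qp \<equiv> decides_within qp w
    (matrix_check (equation_prog e0 y0 f0 c0 e1 y1 f1 c1) (flag_expr chk)) n x
    (check_time (equation_prog e0 y0 f0 c0 e1 y1 f1 c1) (flag_expr chk) n) 2 (2 * n)"
  shows "run bool_mpv ans \<longleftrightarrow> (ans \<longleftrightarrow> (\<forall>i<n. \<forall>j<n. K i j \<and>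
      (C0 i j \<noteq> 0 \<longleftrightarrow> F0 i j \<or> (\<exists>k<n. E0 i k \<and> Y0 j k)) \<and>
      (C1 i j \<noteq> 0 \<longleftrightarrow> F1 i j \<or> (\<exists>k<n. E1 i k \<and> Y1 j k))))"
    and "run int_mpv ans \<longleftrightarrow> (ans \<longleftrightarrow> (\<forall>i<n. \<forall>j<n. K i j \<and>
      C0 i j = (\<Sum>k<n. of_bool (E0 i k \<and> Y0 j k)) + of_bool (F0 i j) \<and>
      C1 i j = (\<Sum>k<n. of_bool (E1 i k \<and> Y1 j k)) + of_bool (F1 i j)))"
proof -
  let ?es = "equation_prog e0 y0 f0 c0 e1 y1 f1 c1"
  note wb = word_bounds(1,2)[OF w]
  have es: "\<forall>e\<in>set (flag_expr chk # ?es). input_expr e" "length ?es = 6"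
    using input_expr_blocks[OF e0] input_expr_blocks[OF y0] input_expr_blocks[OF c0]
      input_expr_blocks[OF e1] input_expr_blocks[OF y1] input_expr_blocks[OF c1]
      input_expr_blocks[OF chk] f0 f1
    by (simp_all add: equation_prog_def)
  let ?cells = "\<lambda>e. flatten (2 * n) (\<lambda>i j. aval w (cell_store n x i j) e)"
  let ?b = "\<lambda>P i j. of_bool (P i j) :: nat"
  have cells: "?cells (?es ! 0) = flatten (2 * n) (block_left n (?b E0))"
    "?cells (?es ! 1) = flatten (2 * n) (block_right n (?b Y0) (?b F0))"
    "?cells (?es ! 2) = flatten (2 * n) (block_out n C0)"
    "?cells (?es ! 3) = flatten (2 * n) (block_left n (?b E1))"
    "?cells (?es ! 4) = flatten (2 * n) (block_right n (?b Y1) (?b F1))"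
    "?cells (?es ! 5) = flatten (2 * n) (block_out n C1)"
    using aval_left_expr[OF wb e0] aval_right_expr[OF wb y0 f0] aval_out_expr[OF wb c0]
      aval_left_expr[OF wb e1] aval_right_expr[OF wb y1 f1] aval_out_expr[OF wb c1]
    by (simp_all add: equation_prog_def cong: flatten_cong)
  have flag: "(\<forall>i<2 * n. \<forall>j<2 * n. aval w (cell_store n x i j) (flag_expr chk) \<noteq> 0) \<longleftrightarrow>
      (\<forall>i<n. \<forall>j<n. K i j)"
    unfolding aval_flag_expr[OF wb chk] by auto
  have sum: "(\<Sum>k<n. ?b E i k * ?b Y j k) = (\<Sum>k<n. of_bool (E i k \<and> Y j k))" for E Y i j
    by (simp add: of_bool_conj)
  note D = decides_within_matrix_check[OF wb x es, unfolded cells flag]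
  show "run int_mpv ans \<longleftrightarrow> (ans \<longleftrightarrow> (\<forall>i<n. \<forall>j<n. K i j \<and>
      C0 i j = (\<Sum>k<n. of_bool (E0 i k \<and> Y0 j k)) + of_bool (F0 i j) \<and>
      C1 i j = (\<Sum>k<n. of_bool (E1 i k \<and> Y1 j k)) + of_bool (F1 i j)))"
    unfolding run_def D[of int_mpv, unfolded int_mpv_blocks sum] conj_all2 by (rule refl)
  have nz: "(\<Sum>k<n. of_bool (E i k \<and> Y j k)) + of_bool (F i j) \<noteq> (0::nat) \<longleftrightarrow>
      F i j \<or> (\<exists>k<n. E i k \<and> Y j k)" for E Y F :: "nat \<Rightarrow> nat \<Rightarrow> bool" and i j
    by auto
  show "run bool_mpv ans \<longleftrightarrow> (ans \<longleftrightarrow> (\<forall>i<n. \<forall>j<n. K i j \<and>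
      (C0 i j \<noteq> 0 \<longleftrightarrow> F0 i j \<or> (\<exists>k<n. E0 i k \<and> Y0 j k)) \<and>
      (C1 i j \<noteq> 0 \<longleftrightarrow> F1 i j \<or> (\<exists>k<n. E1 i k \<and> Y1 j k))))"
    unfolding run_def D[of bool_mpv, unfolded bool_mpv_blocks sum nz] conj_all2 by (rule refl)
qed

lemma check_time_bigo: "(\<lambda>n. real (check_time es ef n)) \<in> O(\<lambda>n. real n ^ 2)"
proof (rule bigoI)
  let ?c = "4 * (body_time es ef + 6) + 30"
  \<comment> \<open>The additive 30 is absorbed by \<open>n ^ 2\<close> from \<open>n = 1\<close>
    on.\<close>
  have "check_time es ef n \<le> ?c * n ^ 2" if "1 \<le> n" for n
  proof -
    have "1 \<le> n ^ 2" using that by simp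
    then show ?thesis by (simp add: check_time_def power2_eq_square algebra_simps)
  qed
  then have "real (check_time es ef n) \<le> real ?c * real n ^ 2" if "1 \<le> n" for n
    using that by (simp only: flip: of_nat_power of_nat_mult) (simp only: of_nat_le_iff)
  then show "\<forall>\<^sub>F n in at_top. norm (real (check_time es ef n)) \<le> real ?c * norm (real n ^ 2)"
    by (intro eventually_at_top_linorderI[of 1]) simp
qed

lemma linear_bigo: "(\<lambda>n. real (2 * n)) \<in> O(\<lambda>n. real n)"
  by (rule bigoI[of _ 2]) simp

lemma square_bigo: "(\<lambda>n. real (2 * n * n)) \<in> O(\<lambda>n. real n ^ 2)"
  by (rule bigoI[of _ 2]) (simp add: power2_eq_square)

section \<open>Encoded instances and certificates\<close>

lemma rel_bits_nth:
  assumes "i < n" "j < n"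
  shows "rel_bits n R ! (i * n + j) = of_bool ((i, j) \<in> R)"
proof -
  have "(i * n + j) div n = i" "(i * n + j) mod n = j" using assms by auto
  then show ?thesis using mult_add_less[OF assms] by (simp add: rel_bits_def)
qed

lemma length_rel_bits: "length (rel_bits n R) = n * n"
  by (simp add: rel_bits_def)

lemma initial_store_nth:
  "a < length x \<Longrightarrow> i < length (x ! a) \<Longrightarrow> arr (initial_store n x) a i = x ! a ! i"
  by (simp add: initial_store_def)

lemma initial_store_less:
  assumes "\<forall>a\<in>set x. words w a"
  shows "arr (initial_store n x) a i < 2 ^ w"
  using assms by (auto simp: initial_store_def words_def all_set_conv_all_nth)

context
  fixes w n :: nat and x :: "nat list list"
  assumes word: "4 * n * n < 2 ^ w" "2 \<le> w"
begin

lemma holds_rel_bits: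
  assumes "a < 9" "a < length x" "x ! a = rel_bits n R"
  shows "holds w n x (entry a) (\<lambda>i j. (i, j) \<in> R)"
  using assms word_gt_1[OF word]
  by (intro denotes_entry[OF word])
    (auto simp: initial_store_nth length_rel_bits mult_add_less rel_bits_nth)

lemma holds_config_bits:
  assumes "a < 9" "a < length x" "x ! a = config_bits n X"
  shows "holds w n x (entry a) (\<lambda>i j. (Alice, i, j) \<in> X)"
    and "holds w n x (entry2 a) (\<lambda>i j. (Bob, i, j) \<in> X)"
proof -
  have "config_bits n X ! (i * n + j) = of_bool ((Alice, i, j) \<in> X)"
    "config_bits n X ! (n * n + (i * n + j)) = of_bool ((Bob, i, j) \<in> X)"
    "i * n + j < length (config_bits n X)" "n * n + (i * n + j) < length (config_bits n X)"
    if "i < n" "j < n" for i j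
    using mult_add_less[OF that] that
    by (simp_all add: config_bits_def nth_append length_rel_bits rel_bits_nth)
  then show "holds w n x (entry a) (\<lambda>i j. (Alice, i, j) \<in> X)"
    "holds w n x (entry2 a) (\<lambda>i j. (Bob, i, j) \<in> X)"
    using assms word_gt_1[OF word]
    by (intro denotes_entry[OF word] denotes_entry2[OF word]; simp add: initial_store_nth)+
qed

text \<open>Covers certificates of any length: words beyond the end read as 0, so every certificate
  denotes two matrices.\<close>

lemma denotes_words:
  assumes "a < 9" "\<forall>a\<in>set x. words w a"
  shows "denotes w n x (entry a) (\<lambda>i j. arr (initial_store n x) a (i * n + j))"
    and "denotes w n x (entry2 a) (\<lambda>i j. arr (initial_store n x) a (n * n + (i * n + j)))"
  using assms initial_store_less[OF assms(2)]
  by (intro denotes_entry[OF word] denotes_entry2[OF word]; simp)+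

end

lemma certificate_exists:
  assumes "\<And>i j. i < n \<Longrightarrow> j < n \<Longrightarrow> c0 i j < 2 ^ w" "\<And>i j. i < n \<Longrightarrow> j < n \<Longrightarrow> c1 i j < 2 ^ w"
  shows "\<exists>z. length z \<le> 2 * n * n \<and> words w z \<and> (\<forall>i<n. \<forall>j<n.
    arr (initial_store n (x @ [z])) (length x) (i * n + j) = c0 i j \<and>
    arr (initial_store n (x @ [z])) (length x) (n * n + (i * n + j)) = c1 i j)"
proof (intro exI conjI allI impI)
  define z where "z = map (\<lambda>k. c0 (k div n) (k mod n)) [0..<n * n] @
    map (\<lambda>k. c1 (k div n) (k mod n)) [0..<n * n]"
  show "length z \<le> 2 * n * n" by (simp add: z_def)
  have "k div n < n \<and> k mod n < n" if "k < n * n" for k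
    using that by (cases "n = 0") (simp_all add: less_mult_imp_div_less)
  then show "words w z" using assms by (auto simp: words_def z_def)
  fix i j assume ij: "i < n" "j < n"
  then have "(i * n + j) div n = i" "(i * n + j) mod n = j" by auto
  then show "arr (initial_store n (x @ [z])) (length x) (i * n + j) = c0 i j"
    "arr (initial_store n (x @ [z])) (length x) (n * n + (i * n + j)) = c1 i j"
    using mult_add_less[OF ij] by (simp_all add: initial_store_def z_def nth_append)
qed

text \<open>At most \<open>n\<close> good moves and one for stopping; this bounds the entries of an
  honest certificate.\<close>

lemma sum_of_bool_le: "(\<Sum>k<n. of_bool (P k)) + of_bool Q \<le> n + (1::nat)"
proof -
  have "(\<Sum>k<n. of_bool (P k)) \<le> (\<Sum>k<n. 1::nat)" by (intro sum_mono) simp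
  then show ?thesis by simp
qed

section \<open>Correct outputs as solutions of product equations\<close>

text \<open>By determinacy Bob's winning set fixes the other three sets, so these are compared
  entrywise and only \<open>W Bob\<close> has to satisfy the equations.\<close>

lemma semi_acyclic_outputs_iff:
  fixes n :: nat
  assumes inst: "semi_acyclic_trg_instance (\<lambda>_. {..<n}) E F"
    and sub: "\<forall>P. W P \<subseteq> configs (token_game (\<lambda>_. {..<n}) E) \<and> S P \<subseteq> configs (token_game (\<lambda>_. {..<n}) E)"
  shows "(\<forall>P. W P = winning_set (token_game (\<lambda>_. {..<n}) E) F P \<and>
        S P = surviving_set (token_game (\<lambda>_. {..<n}) E) F P) \<longleftrightarrow>
    (\<forall>u<n. \<forall>v<n. (\<forall>P. ((P, u, v) \<in> W Alice \<longleftrightarrow> (P, u, v) \<notin> W Bob) \<and>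
        ((P, u, v) \<in> S Alice \<longleftrightarrow> (P, u, v) \<notin> W Bob) \<and> ((P, u, v) \<in> S Bob \<longleftrightarrow> (P, u, v) \<in> W Bob)) \<and>
      ((Alice, u, v) \<notin> W Bob \<longleftrightarrow>
        (Alice, u, v) \<in> F Alice \<or> (\<exists>u'<n. (u, u') \<in> E Alice \<and> (Bob, v, u') \<notin> W Bob)) \<and>
      ((Bob, u, v) \<in> W Bob \<longleftrightarrow>
        (Bob, u, v) \<in> F Bob \<or> (\<exists>u'<n. (u, u') \<in> E Bob \<and> (Alice, v, u') \<in> W Bob)))"
    (is "?L \<longleftrightarrow> (\<forall>u<n. \<forall>v<n. ?A u v \<and> ?B u v \<and> ?C u v)")
proof -
  let ?G = "token_game (\<lambda>_. {..<n}) E"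
  have conf: "(P, u, v) \<in> configs ?G \<longleftrightarrow> u < n \<and> v < n" for P u v
    by (auto simp: token_game_def)
  note det = wf_game_determined[OF semi_acyclic_game[OF inst]]
  have "winning_set ?G F Alice = configs ?G - winning_set ?G F Bob"
    using det(3)[of Bob] by simp
  then have "?L \<longleftrightarrow> W Bob = winning_set ?G F Bob \<and> W Alice = configs ?G - W Bob \<and>
      S Alice = configs ?G - W Bob \<and> S Bob = W Bob"
    unfolding all_player det(2) by metis
  also have "\<dots> \<longleftrightarrow> W Bob = winning_set ?G F Bob \<and> (\<forall>u<n. \<forall>v<n. ?A u v)"
  proof -
    have "X = Y \<longleftrightarrow> (\<forall>u<n. \<forall>v<n. \<forall>P. (P, u, v) \<in> X \<longleftrightarrow> (P, u, v) \<in> Y)"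
      if "X \<subseteq> configs ?G" "Y \<subseteq> configs ?G" for X Y
    proof
      assume *: "\<forall>u<n. \<forall>v<n. \<forall>P. (P, u, v) \<in> X \<longleftrightarrow> (P, u, v) \<in> Y"
      have "\<sigma> \<in> X \<longleftrightarrow> \<sigma> \<in> Y" for \<sigma>
      proof (cases \<sigma>)
        case (fields P u v)
        then show ?thesis using * that conf[of P u v] by blast
      qed
      then show "X = Y" by blast
    qed simp
    note eq = this
    have "W Alice = configs ?G - W Bob \<longleftrightarrow>
        (\<forall>u<n. \<forall>v<n. \<forall>P. (P, u, v) \<in> W Alice \<longleftrightarrow> (P, u, v) \<notin> W Bob)"
      "S Alice = configs ?G - W Bob \<longleftrightarrow>
        (\<forall>u<n. \<forall>v<n. \<forall>P. (P, u, v) \<in> S Alice \<longleftrightarrow> (P, u, v) \<notin> W Bob)"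
      "S Bob = W Bob \<longleftrightarrow>
        (\<forall>u<n. \<forall>v<n. \<forall>P. (P, u, v) \<in> S Bob \<longleftrightarrow> (P, u, v) \<in> W Bob)"
      using sub eq[of "W Alice" "configs ?G - W Bob"] eq[of "S Alice" "configs ?G - W Bob"]
        eq[of "S Bob" "W Bob"]
      by (simp_all add: conf)
    note eqs = this
    show ?thesis unfolding eqs by (simp only: all_conj_distrib imp_conjR)
  qed
  also have "W Bob = winning_set ?G F Bob \<longleftrightarrow> (\<forall>u<n. \<forall>v<n. ?B u v \<and> ?C u v)"
    by (rule semi_acyclic_winning_set_iff[OF inst]) (use sub in blast)
  also have "(\<forall>u<n. \<forall>v<n. ?B u v \<and> ?C u v) \<and> (\<forall>u<n. \<forall>v<n. ?A u v) \<longleftrightarrow>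
      (\<forall>u<n. \<forall>v<n. ?A u v \<and> ?B u v \<and> ?C u v)"
    by (rule trans[OF conj_commute conj_all2])
  finally show ?thesis .
qed

text \<open>A candidate \<open>R\<close> shows only the configurations of Alice; \<open>Y\<close> is
  the missing part at those of Bob. The goal of Bob contains no configuration of his own, so the
  second equation has no stopping bit and determines \<open>Y\<close> from \<open>R\<close>.\<close>

lemma acyclic_simulation_iff:
  fixes n :: nat
  assumes T: "finite_digraph {..<n} T" "acyclic T" and R: "R \<subseteq> {..<n} \<times> {..<n}"
  shows "R = {(s, t) \<in> {..<n} \<times> {..<n}. simulates {..<n} T L t s} \<longleftrightarrow>
    (\<exists>Y. \<forall>u<n. \<forall>v<n.
      ((u, v) \<notin> R \<longleftrightarrow> L u \<noteq> L v \<or> (\<exists>u'<n. (u, u') \<in> T \<and> \<not> Y v u')) \<and>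
      (Y u v \<longleftrightarrow> (\<exists>u'<n. (u, u') \<in> T \<and> (v, u') \<in> R)))"
    (is "?L \<longleftrightarrow> (\<exists>Y. ?sol Y)")
proof -
  let ?G = "token_game (\<lambda>_. {..<n}) (\<lambda>_. T)" and ?F = "simulation_goal {..<n} T L"
  have inst: "semi_acyclic_trg_instance (\<lambda>_. {..<n}) (\<lambda>_. T) ?F"
    using T reachability_game_simulation[OF T(1), of L]
    by (simp add: semi_acyclic_trg_instance_def trg_instance_def simulation_graph_def)
  have conf: "(P, u, v) \<in> configs ?G \<longleftrightarrow> u < n \<and> v < n" for P u v
    by (auto simp: token_game_def)
  have F: "(Alice, u, v) \<in> ?F Alice \<longleftrightarrow> L u \<noteq> L v" "(Bob, u, v) \<notin> ?F Bob"
    if "u < n" "v < n" for u v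
    using that conf by (auto simp: simulation_goal_def simulation_graph_def)
  define W where "W = winning_set ?G ?F Bob"
  have sim: "simulates {..<n} T L t s \<longleftrightarrow> (Alice, s, t) \<in> W" for s t
    unfolding simulates_def simulation_graph_def W_def
    using wf_game_determined(2)[OF semi_acyclic_game[OF inst]] by simp
  have W: "W \<subseteq> configs ?G" by (auto simp: W_def winning_set_def)
  note iff = semi_acyclic_winning_set_iff[OF inst]
  have R_iff: "?L \<longleftrightarrow> (\<forall>u<n. \<forall>v<n. (u, v) \<in> R \<longleftrightarrow> (Alice, u, v) \<in> W)"
  proof
    assume L: ?L
    show "\<forall>u<n. \<forall>v<n. (u, v) \<in> R \<longleftrightarrow> (Alice, u, v) \<in> W"
      by (subst L) (simp add: sim)
  next
    assume *: "\<forall>u<n. \<forall>v<n. (u, v) \<in> R \<longleftrightarrow> (Alice, u, v) \<in> W"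
    have "(u, v) \<in> R \<longleftrightarrow> u < n \<and> v < n \<and> (Alice, u, v) \<in> W" for u v
      using * R by blast
    then show ?L by (auto simp: sim)
  qed
  show ?thesis
  proof
    assume ?L
    then have R': "(u, v) \<in> R \<longleftrightarrow> (Alice, u, v) \<in> W" if "u < n" "v < n" for u v
      using iffD1[OF R_iff \<open>?L\<close>] that by blast
    have "W = winning_set ?G ?F Bob \<longleftrightarrow> ?sol (\<lambda>u v. (Bob, u, v) \<in> W)"
      unfolding iff[OF W] by (simp add: F R' cong: conj_cong)
    from this W_def have "?sol (\<lambda>u v. (Bob, u, v) \<in> W)" by (rule iffD1)
    then show "\<exists>Y. ?sol Y" by (rule exI[of ?sol])
  next
    assume "\<exists>Y. ?sol Y"
    then obtain Y where Y: "?sol Y" by blast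
    \<comment> \<open>Glues \<open>R\<close> and \<open>Y\<close> to a candidate winning set; the
      bounds keep it among the configurations.\<close>
    define X where "X = {(Alice, u, v) | u v. (u, v) \<in> R} \<union> {(Bob, u, v) | u v. u < n \<and> v < n \<and> Y u v}"
    have X: "X \<subseteq> configs ?G" using R conf by (auto simp: X_def)
    have "(Alice, u, v) \<in> X \<longleftrightarrow> (u, v) \<in> R" "(Bob, u, v) \<in> X \<longleftrightarrow> Y u v"
      if "u < n" "v < n" for u v
      using that by (auto simp: X_def)
    note X_iff = this
    have "X = W \<longleftrightarrow> ?sol Y"
      unfolding W_def iff[OF X] by (simp add: F X_iff cong: conj_cong)
    from this Y have "X = W" by (rule iffD2)
    then have "\<forall>u<n. \<forall>v<n. (u, v) \<in> R \<longleftrightarrow> (Alice, u, v) \<in> W"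
      using X_iff(1) by blast
    then show ?L by (rule iffD2[OF R_iff])
  qed
qed

section \<open>Verifying the semi-acyclic two-token game\<close>

text \<open>The entrywise consequences of determinacy; arrays 4 to 7 hold \<open>W Alice\<close>,
  \<open>W Bob\<close>, \<open>S Alice\<close>, \<open>S Bob\<close>.\<close>

definition agree_expr :: "aexp \<Rightarrow> aexp \<Rightarrow> aexp" where
  "agree_expr p q = Mul
     (Mul (Equal (entry 4 p q) (Equal (Const 0) (entry 5 p q)))
       (Mul (Equal (entry 6 p q) (Equal (Const 0) (entry 5 p q)))
         (Equal (entry 7 p q) (entry 5 p q))))
     (Mul (Equal (entry2 4 p q) (Equal (Const 0) (entry2 5 p q)))
       (Mul (Equal (entry2 6 p q) (Equal (Const 0) (entry2 5 p q)))
         (Equal (entry2 7 p q) (entry2 5 p q))))"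

definition trg_arrays ::
    "nat \<Rightarrow> (player \<Rightarrow> (nat \<times> nat) set) \<Rightarrow> (player \<Rightarrow> nat token_config set) \<Rightarrow>
     (player \<Rightarrow> nat token_config set) \<Rightarrow> (player \<Rightarrow> nat token_config set) \<Rightarrow> nat list list" where
  "trg_arrays n E F W S =
     [rel_bits n (E Alice), rel_bits n (E Bob),
      config_bits n (F Alice), config_bits n (F Bob),
      config_bits n (W Alice), config_bits n (W Bob),
      config_bits n (S Alice), config_bits n (S Bob)]"

text \<open>\<open>zs\<close> is empty without a certificate and a singleton with one, so both
  verifiers share these facts.\<close>

lemma holds_trg_arrays:
  fixes n w :: nat and zs :: "nat list list"
    and E :: "player \<Rightarrow> (nat \<times> nat) set" and F W S :: "player \<Rightarrow> nat token_config set"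
  assumes "4 * n * n < 2 ^ w" "2 \<le> w" "length zs \<le> 1"
  defines "x \<equiv> trg_arrays n E F W S @ zs"
  shows "holds w n x (entry 0) (\<lambda>i j. (i, j) \<in> E Alice)"
    and "holds w n x (entry 1) (\<lambda>i j. (i, j) \<in> E Bob)"
    and "holds w n x (entry 2) (\<lambda>i j. (Alice, i, j) \<in> F Alice)"
    and "holds w n x (entry2 3) (\<lambda>i j. (Bob, i, j) \<in> F Bob)"
    and "holds w n x (entry 5) (\<lambda>i j. (Alice, i, j) \<in> W Bob)"
    and "holds w n x (entry2 5) (\<lambda>i j. (Bob, i, j) \<in> W Bob)"
    and "holds w n x agree_expr (\<lambda>i j. \<forall>P. ((P, i, j) \<in> W Alice \<longleftrightarrow> (P, i, j) \<notin> W Bob) \<and>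
        ((P, i, j) \<in> S Alice \<longleftrightarrow> (P, i, j) \<notin> W Bob) \<and> ((P, i, j) \<in> S Bob \<longleftrightarrow> (P, i, j) \<in> W Bob))"
proof -
  note wb = assms(1,2)
  have len: "length x = 8 + length zs" by (simp add: x_def trg_arrays_def)
  have nth: "x ! 0 = rel_bits n (E Alice)" "x ! Suc 0 = rel_bits n (E Bob)"
    "x ! 2 = config_bits n (F Alice)" "x ! 3 = config_bits n (F Bob)"
    "x ! 4 = config_bits n (W Alice)" "x ! 5 = config_bits n (W Bob)"
    "x ! 6 = config_bits n (S Alice)" "x ! 7 = config_bits n (S Bob)"
    unfolding x_def trg_arrays_def by simp_all
  note h = holds_rel_bits[OF wb] holds_config_bits[OF wb]
  show "holds w n x (entry 0) (\<lambda>i j. (i, j) \<in> E Alice)"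
    "holds w n x (entry 1) (\<lambda>i j. (i, j) \<in> E Bob)"
    by (intro h; simp add: len nth)+
  have F: "holds w n x (entry 2) (\<lambda>i j. (Alice, i, j) \<in> F Alice)"
    "holds w n x (entry2 3) (\<lambda>i j. (Bob, i, j) \<in> F Bob)"
    by (rule h; simp add: len nth)+
  have 4: "holds w n x (entry 4) (\<lambda>i j. (Alice, i, j) \<in> W Alice)"
    "holds w n x (entry2 4) (\<lambda>i j. (Bob, i, j) \<in> W Alice)"
    by (rule h; simp add: len nth)+
  have 5: "holds w n x (entry 5) (\<lambda>i j. (Alice, i, j) \<in> W Bob)"
    "holds w n x (entry2 5) (\<lambda>i j. (Bob, i, j) \<in> W Bob)"
    by (rule h; simp add: len nth)+
  have 6: "holds w n x (entry 6) (\<lambda>i j. (Alice, i, j) \<in> S Alice)"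
    "holds w n x (entry2 6) (\<lambda>i j. (Bob, i, j) \<in> S Alice)"
    by (rule h; simp add: len nth)+
  have 7: "holds w n x (entry 7) (\<lambda>i j. (Alice, i, j) \<in> S Bob)"
    "holds w n x (entry2 7) (\<lambda>i j. (Bob, i, j) \<in> S Bob)"
    by (rule h; simp add: len nth)+
  show "holds w n x (entry 2) (\<lambda>i j. (Alice, i, j) \<in> F Alice)"
    "holds w n x (entry2 3) (\<lambda>i j. (Bob, i, j) \<in> F Bob)"
    "holds w n x (entry 5) (\<lambda>i j. (Alice, i, j) \<in> W Bob)"
    "holds w n x (entry2 5) (\<lambda>i j. (Bob, i, j) \<in> W Bob)"
    by (fact F 5)+
  note eq = holds_eq[OF wb] and neg = holds_neg[OF wb] and conj = holds_conj[OF wb]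
  note agree = conj[OF
    conj[OF eq[OF 4(1) neg[OF 5(1)]] conj[OF eq[OF 6(1) neg[OF 5(1)]] eq[OF 7(1) 5(1)]]]
    conj[OF eq[OF 4(2) neg[OF 5(2)]] conj[OF eq[OF 6(2) neg[OF 5(2)]] eq[OF 7(2) 5(2)]]]]
  then show "holds w n x agree_expr (\<lambda>i j. \<forall>P. ((P, i, j) \<in> W Alice \<longleftrightarrow> (P, i, j) \<notin> W Bob) \<and>
        ((P, i, j) \<in> S Alice \<longleftrightarrow> (P, i, j) \<notin> W Bob) \<and> ((P, i, j) \<in> S Bob \<longleftrightarrow> (P, i, j) \<in> W Bob))"
    unfolding agree_expr_def[abs_def] all_player by (simp add: of_bool_eq_iff)
qed

lemma semi_acyclic_trg_verification_cases:
  assumes "(n, x, correct) \<in> semi_acyclic_trg_verification"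
  obtains E F W S where "x = trg_arrays n E F W S"
    and "correct \<longleftrightarrow> (\<forall>u<n. \<forall>v<n. (\<forall>P. ((P, u, v) \<in> W Alice \<longleftrightarrow> (P, u, v) \<notin> W Bob) \<and>
        ((P, u, v) \<in> S Alice \<longleftrightarrow> (P, u, v) \<notin> W Bob) \<and> ((P, u, v) \<in> S Bob \<longleftrightarrow> (P, u, v) \<in> W Bob)) \<and>
      ((Alice, u, v) \<notin> W Bob \<longleftrightarrow>
        (Alice, u, v) \<in> F Alice \<or> (\<exists>u'<n. (u, u') \<in> E Alice \<and> (Bob, v, u') \<notin> W Bob)) \<and>
      ((Bob, u, v) \<in> W Bob \<longleftrightarrow>
        (Bob, u, v) \<in> F Bob \<or> (\<exists>u'<n. (u, u') \<in> E Bob \<and> (Alice, v, u') \<in> W Bob)))"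
proof -
  obtain E F W S where x: "x = trg_arrays n E F W S"
    and correct: "correct \<longleftrightarrow> (\<forall>P. W P = winning_set (token_game (\<lambda>_. {..<n}) E) F P \<and>
      S P = surviving_set (token_game (\<lambda>_. {..<n}) E) F P)"
    and inst: "semi_acyclic_trg_instance (\<lambda>_. {..<n}) E F"
    and sub: "\<forall>P. W P \<subseteq> configs (token_game (\<lambda>_. {..<n}) E) \<and>
      S P \<subseteq> configs (token_game (\<lambda>_. {..<n}) E)"
    using assms unfolding semi_acyclic_trg_verification_def trg_arrays_def by blast
  show thesis
    by (rule that[OF x]) (use correct semi_acyclic_outputs_iff[OF inst sub] in \<open>simp only:\<close>)
qed

lemma holds_neg_bit:
  assumes "4 * n * n < 2 ^ w" "2 \<le> w" "holds w n x e P"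
  shows "holds w n x (\<lambda>p q. Equal (Const 0) (e p q)) (\<lambda>i j. \<not> P i j)"
  using holds_neg[OF assms] by simp

lemma trg_verifiable: "verifiable_via bool_mpv semi_acyclic_trg_verification"
proof -
  let ?neg = "\<lambda>e p q. Equal (Const 0) (e p q)"
  \<comment> \<open>With array 5 giving \<open>x0\<close> and \<open>x1\<close>, the equations are
    \<open>\<not> x0 = f0 \<or> E0 \<star> (\<not> x1)^T\<close> and
    \<open>x1 = f1 \<or> E1 \<star> x0^T\<close>; every matrix is read off the input.\<close>
  let ?es = "equation_prog (entry 0) (?neg (entry2 5)) (entry 2) (?neg (entry 5))
    (entry 1) (entry 5) (entry2 3) (entry2 5)"
  have "decides_within bool_mpv w (matrix_check ?es (flag_expr agree_expr)) n x
      (check_time ?es (flag_expr agree_expr) n) 2 (2 * n) correct"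
    if A: "(n, x, correct) \<in> semi_acyclic_trg_verification" and w: "(n + 2) ^ 4 \<le> 2 ^ w"
    for n x correct w
  proof -
    obtain E F W S where x: "x = trg_arrays n E F W S" and correct:
      "correct \<longleftrightarrow> (\<forall>u<n. \<forall>v<n. (\<forall>P. ((P, u, v) \<in> W Alice \<longleftrightarrow> (P, u, v) \<notin> W Bob) \<and>
        ((P, u, v) \<in> S Alice \<longleftrightarrow> (P, u, v) \<notin> W Bob) \<and> ((P, u, v) \<in> S Bob \<longleftrightarrow> (P, u, v) \<in> W Bob)) \<and>
      ((Alice, u, v) \<notin> W Bob \<longleftrightarrow>
        (Alice, u, v) \<in> F Alice \<or> (\<exists>u'<n. (u, u') \<in> E Alice \<and> (Bob, v, u') \<notin> W Bob)) \<and>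
      ((Bob, u, v) \<in> W Bob \<longleftrightarrow>
        (Bob, u, v) \<in> F Bob \<or> (\<exists>u'<n. (u, u') \<in> E Bob \<and> (Alice, v, u') \<in> W Bob)))"
      by (rule semi_acyclic_trg_verification_cases[OF A])
    note wb = word_bounds(1,2)[OF w]
    have x': "x = trg_arrays n E F W S @ []" by (simp add: x)
    have len: "length x \<le> 9" by (simp add: x trg_arrays_def)
    have "length ([] :: nat list list) \<le> 1" by simp
    note h = holds_trg_arrays[OF wb this, of E F W S, folded x']
    show ?thesis
      by (rule iffD2[OF decides_equation_prog(1)[OF w len h(1) holds_neg_bit[OF wb h(6)] h(3)
          holds_neg_bit[OF wb h(5)] h(2) h(5) h(4) h(6) h(7)]])
        (simp only: correct of_bool_eq_0_iff not_not)
  qed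
  then show ?thesis
    unfolding verifiable_via_def
    by (intro exI[of _ "matrix_check ?es (flag_expr agree_expr)"]
        exI[of _ "check_time ?es (flag_expr agree_expr)"] exI[of _ "\<lambda>n. 2 * n"]
        exI[of _ 2] exI[of _ 4] conjI check_time_bigo linear_bigo) auto
qed

text \<open>An acceptance predicate \<open>V\<close> describing the verdict exactly yields both that
  the program always answers and that it accepts only for correct candidates. The size
  \<open>2 * n * n\<close> is that of two products.\<close>

lemma certifiable_viaI:
  assumes "\<And>n x correct w. (n, x, correct) \<in> A \<Longrightarrow> (n + 2) ^ 4 \<le> 2 ^ w \<Longrightarrow> \<forall>a\<in>set x. words w a \<Longrightarrow>
    \<exists>V. (\<forall>z ans. words w z \<longrightarrow>
        (decides_within qp w (matrix_check es ef) n (x @ [z]) (check_time es ef n) 2 (2 * n) ans \<longleftrightarrow>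
          (ans \<longleftrightarrow> V z))) \<and>
      (correct \<longleftrightarrow> (\<exists>z. length z \<le> 2 * n * n \<and> words w z \<and> V z))"
  shows "certifiable_via qp A"
proof -
  have "(\<forall>z\<in>{z. length z \<le> 2 * n * n \<and> words w z}. \<exists>ans.
        decides_within qp w (matrix_check es ef) n (x @ [z]) (check_time es ef n) 2 (2 * n) ans) \<and>
      (correct \<longleftrightarrow> (\<exists>z\<in>{z. length z \<le> 2 * n * n \<and> words w z}.
        decides_within qp w (matrix_check es ef) n (x @ [z]) (check_time es ef n) 2 (2 * n) True))"
    if A: "(n, x, correct) \<in> A" "(n + 2) ^ 4 \<le> 2 ^ w" "\<forall>a\<in>set x. words w a" for n x correct w
  proof -
    obtain V where V: "\<And>z ans. words w z \<Longrightarrow> decides_within qp w (matrix_check es ef) n (x @ [z])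
        (check_time es ef n) 2 (2 * n) ans \<longleftrightarrow> (ans \<longleftrightarrow> V z)"
      and correct: "correct \<longleftrightarrow> (\<exists>z. length z \<le> 2 * n * n \<and> words w z \<and> V z)"
      using assms[OF A] by blast
    show ?thesis
      unfolding correct using V by auto
  qed
  then show ?thesis
    unfolding certifiable_via_def Let_def
    by (intro exI[of _ "matrix_check es ef"] exI[of _ "\<lambda>n. 2 * n * n"]
        exI[of _ "check_time es ef"] exI[of _ "\<lambda>n. 2 * n"]
        exI[of _ 2] exI[of _ 4] conjI check_time_bigo linear_bigo square_bigo) blast
qed

text \<open>A one-point rule: the certificate is pinned to \<open>d0\<close> and \<open>d1\<close>,
  so the quantifier disappears and the remaining checks concern these values.\<close>

lemma exists_certificate_iff:
  fixes n w :: nat and x :: "nat list list"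
  assumes "\<And>i j. i < n \<Longrightarrow> j < n \<Longrightarrow> d0 i j < 2 ^ w" "\<And>i j. i < n \<Longrightarrow> j < n \<Longrightarrow> d1 i j < 2 ^ w"
  defines "c0 z i j \<equiv> arr (initial_store n (x @ [z])) (length x) (i * n + j)"
    and "c1 z i j \<equiv> arr (initial_store n (x @ [z])) (length x) (n * n + (i * n + j))"
  shows "(\<exists>z. length z \<le> 2 * n * n \<and> words w z \<and>
      (\<forall>i<n. \<forall>j<n. Q i j (c0 z i j) (c1 z i j) \<and> c0 z i j = d0 i j \<and> c1 z i j = d1 i j)) \<longleftrightarrow>
    (\<forall>i<n. \<forall>j<n. Q i j (d0 i j) (d1 i j))"
proof
  assume *: "\<forall>i<n. \<forall>j<n. Q i j (d0 i j) (d1 i j)"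
  obtain z where "length z \<le> 2 * n * n" "words w z"
    and c: "\<forall>i<n. \<forall>j<n. c0 z i j = d0 i j \<and> c1 z i j = d1 i j"
    unfolding c0_def c1_def using certificate_exists[of n d0 w d1 x, OF assms(1,2)] by blast
  moreover have "\<forall>i<n. \<forall>j<n. Q i j (c0 z i j) (c1 z i j) \<and> c0 z i j = d0 i j \<and> c1 z i j = d1 i j"
    using * by (simp add: c)
  ultimately show "\<exists>z. length z \<le> 2 * n * n \<and> words w z \<and>
      (\<forall>i<n. \<forall>j<n. Q i j (c0 z i j) (c1 z i j) \<and> c0 z i j = d0 i j \<and> c1 z i j = d1 i j)"
    by blast
next
  assume "\<exists>z. length z \<le> 2 * n * n \<and> words w z \<and>
      (\<forall>i<n. \<forall>j<n. Q i j (c0 z i j) (c1 z i j) \<and> c0 z i j = d0 i j \<and> c1 z i j = d1 i j)"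
  then show "\<forall>i<n. \<forall>j<n. Q i j (d0 i j) (d1 i j)" by metis
qed

lemma trg_certifiable: "certifiable_via int_mpv semi_acyclic_trg_verification"
proof (rule certifiable_viaI)
  let ?neg = "\<lambda>e p q. Equal (Const 0) (e p q)" and ?pos = "\<lambda>e p q. Less (Const 0) (e p q)"
  let ?es = "equation_prog (entry 0) (?neg (entry2 5)) (entry 2) (entry 8)
    (entry 1) (entry 5) (entry2 3) (entry2 8)"
  \<comment> \<open>Array 8 is the certificate. The queries make it equal to the counts; the flag
    compares its zero pattern with the candidate.\<close>
  let ?ef = "flag_expr (\<lambda>p q. Mul (agree_expr p q)
    (Mul (Equal (?pos (entry 8) p q) (?neg (entry 5) p q))
      (Equal (?pos (entry2 8) p q) (entry2 5 p q))))"
  fix n x correct w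
  assume A: "(n, x, correct) \<in> semi_acyclic_trg_verification" and w: "(n + 2) ^ 4 \<le> 2 ^ w"
    and words: "\<forall>a\<in>set x. words w a"
  obtain E F W S where x: "x = trg_arrays n E F W S" and correct:
    "correct \<longleftrightarrow> (\<forall>u<n. \<forall>v<n. (\<forall>P. ((P, u, v) \<in> W Alice \<longleftrightarrow> (P, u, v) \<notin> W Bob) \<and>
      ((P, u, v) \<in> S Alice \<longleftrightarrow> (P, u, v) \<notin> W Bob) \<and> ((P, u, v) \<in> S Bob \<longleftrightarrow> (P, u, v) \<in> W Bob)) \<and>
    ((Alice, u, v) \<notin> W Bob \<longleftrightarrow>
      (Alice, u, v) \<in> F Alice \<or> (\<exists>u'<n. (u, u') \<in> E Alice \<and> (Bob, v, u') \<notin> W Bob)) \<and>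
    ((Bob, u, v) \<in> W Bob \<longleftrightarrow>
      (Bob, u, v) \<in> F Bob \<or> (\<exists>u'<n. (u, u') \<in> E Bob \<and> (Alice, v, u') \<in> W Bob)))"
    (is "_ \<longleftrightarrow> (\<forall>u<n. \<forall>v<n. ?agree u v \<and> _ u v \<and> _ u v)")
    by (rule semi_acyclic_trg_verification_cases[OF A])
  note wb = word_bounds[OF w]
  have x8: "length x = 8" by (simp add: x trg_arrays_def)
  define c0 where "c0 z i j = arr (initial_store n (x @ [z])) 8 (i * n + j)" for z i j
  define c1 where "c1 z i j = arr (initial_store n (x @ [z])) 8 (n * n + (i * n + j))" for z i j
  define d0 :: "nat \<Rightarrow> nat \<Rightarrow> nat" where "d0 i j =
    (\<Sum>k<n. of_bool ((i, k) \<in> E Alice \<and> (Bob, j, k) \<notin> W Bob)) + of_bool ((Alice, i, j) \<in> F Alice)" for i j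
  define d1 :: "nat \<Rightarrow> nat \<Rightarrow> nat" where "d1 i j =
    (\<Sum>k<n. of_bool ((i, k) \<in> E Bob \<and> (Alice, j, k) \<in> W Bob)) + of_bool ((Bob, i, j) \<in> F Bob)" for i j
  define Q where "Q i j a b \<longleftrightarrow> ?agree i j \<and>
    (a \<noteq> 0 \<longleftrightarrow> (Alice, i, j) \<notin> W Bob) \<and> (b \<noteq> 0 \<longleftrightarrow> (Bob, i, j) \<in> W Bob)" for i j and a b :: nat
  define V where "V z \<longleftrightarrow>
    (\<forall>i<n. \<forall>j<n. Q i j (c0 z i j) (c1 z i j) \<and> c0 z i j = d0 i j \<and> c1 z i j = d1 i j)" for z
  have "d0 i j < 2 ^ w" "d1 i j < 2 ^ w" for i j
    using sum_of_bool_le wb(3) unfolding d0_def d1_def by (meson le_less_trans)+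
  then have "(\<exists>z. length z \<le> 2 * n * n \<and> words w z \<and> V z) \<longleftrightarrow> (\<forall>i<n. \<forall>j<n. Q i j (d0 i j) (d1 i j))"
    using exists_certificate_iff[of n d0 w d1 Q x]
    by (simp add: V_def c0_def c1_def x8)
  also have "\<dots> \<longleftrightarrow> correct"
  proof -
    have "d0 i j \<noteq> 0 \<longleftrightarrow> (Alice, i, j) \<in> F Alice \<or> (\<exists>k<n. (i, k) \<in> E Alice \<and> (Bob, j, k) \<notin> W Bob)"
      "d1 i j \<noteq> 0 \<longleftrightarrow> (Bob, i, j) \<in> F Bob \<or> (\<exists>k<n. (i, k) \<in> E Bob \<and> (Alice, j, k) \<in> W Bob)" for i j
      by (auto simp: d0_def d1_def)
    then show ?thesis
      unfolding correct Q_def by (simp only: eq_commute)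
  qed
  finally have correct_iff: "correct \<longleftrightarrow> (\<exists>z. length z \<le> 2 * n * n \<and> words w z \<and> V z)" by blast
  have "decides_within int_mpv w (matrix_check ?es ?ef) n (x @ [z])
      (check_time ?es ?ef n) 2 (2 * n) ans \<longleftrightarrow> (ans \<longleftrightarrow> V z)"
    if z: "words w z" for z ans
  proof -
    have len: "length (x @ [z]) \<le> 9" by (simp add: x8)
    have words': "\<forall>a\<in>set (x @ [z]). words w a" using words z by simp
    have "length [z] \<le> 1" by simp
    note h = holds_trg_arrays[OF wb(1,2) this, of E F W S, folded x]
    have "(8::nat) < 9" by simp
    note c = denotes_words[OF wb(1,2) this words']
    note chk = holds_conj[OF wb(1,2) h(7) holds_conj[OF wb(1,2)
        holds_eq[OF wb(1,2) holds_pos[OF wb(1,2) c(1)] holds_neg_bit[OF wb(1,2) h(5)]]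
        holds_eq[OF wb(1,2) holds_pos[OF wb(1,2) c(2)] h(6)]], unfolded of_bool_eq_iff]
    show ?thesis
      unfolding decides_equation_prog(2)[OF w len h(1) holds_neg_bit[OF wb(1,2) h(6)] h(3)
          c(1) h(2) h(5) h(4) c(2) chk] V_def Q_def d0_def d1_def c0_def c1_def
      by (rule refl)
  qed
  with correct_iff show "\<exists>V. (\<forall>z ans. words w z \<longrightarrow> (decides_within int_mpv w (matrix_check ?es ?ef) n (x @ [z])
      (check_time ?es ?ef n) 2 (2 * n) ans \<longleftrightarrow> (ans \<longleftrightarrow> V z))) \<and>
    (correct \<longleftrightarrow> (\<exists>z. length z \<le> 2 * n * n \<and> words w z \<and> V z))"
    by blast
qed

section \<open>Verifying acyclic simulation\<close>

lemma acyclic_simulation_verification_cases: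
  assumes "(n, x, correct) \<in> acyclic_simulation_verification"
  obtains T L R where "x = [rel_bits n T, map L [0..<n], rel_bits n R]"
    and "correct \<longleftrightarrow> (\<exists>Y. \<forall>u<n. \<forall>v<n.
      ((u, v) \<notin> R \<longleftrightarrow> L u \<noteq> L v \<or> (\<exists>u'<n. (u, u') \<in> T \<and> \<not> Y v u')) \<and>
      (Y u v \<longleftrightarrow> (\<exists>u'<n. (u, u') \<in> T \<and> (v, u') \<in> R)))"
proof -
  obtain T L R where x: "x = [rel_bits n T, map L [0..<n], rel_bits n R]"
    and correct: "correct \<longleftrightarrow> R = {(s, t) \<in> {..<n} \<times> {..<n}. simulates {..<n} T L t s}"
    and T: "finite_digraph {..<n} T" "acyclic T" and R: "R \<subseteq> {..<n} \<times> {..<n}"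
    using assms unfolding acyclic_simulation_verification_def by blast
  show thesis
    by (rule that[OF x]) (use correct acyclic_simulation_iff[OF T R, of L] in \<open>rule trans\<close>)
qed

definition label_differs :: "aexp \<Rightarrow> aexp \<Rightarrow> aexp" where
  "label_differs p q = Equal (Const 0) (Equal (Load 1 p) (Load 1 q))"

lemma holds_label_differs:
  assumes "4 * n * n < 2 ^ w" "2 \<le> w" "1 < length x" "x ! 1 = map L [0..<n]"
  shows "holds w n x label_differs (\<lambda>i j. L i \<noteq> L j)"
proof -
  have "arr (initial_store n x) 1 i = L i" if "i < n" for i
    using assms that by (simp add: initial_store_nth)
  then show ?thesis
    using word_gt_1[OF assms(1,2)] by (auto simp: denotes_def label_differs_def)
qed

lemma simulation_certifiable: "certifiable_via int_mpv acyclic_simulation_verification"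
proof (rule certifiable_viaI)
  let ?neg = "\<lambda>e p q. Equal (Const 0) (e p q)" and ?pos = "\<lambda>e p q. Less (Const 0) (e p q)"
  \<comment> \<open>The second query certifies the counts for \<open>x1\<close> in the first half of
    array 3. Their zeros give \<open>\<not> x1\<close>, the right factor of the first query, whose
    counts fill the second half.\<close>
  let ?es = "equation_prog (entry 0) (?neg (entry 3)) label_differs (entry2 3)
    (entry 0) (entry 2) (\<lambda>p q. Const 0) (entry 3)"
  let ?ef = "flag_expr (\<lambda>p q. Equal (?pos (entry2 3) p q) (?neg (entry 2) p q))"
  fix n x correct w
  assume A: "(n, x, correct) \<in> acyclic_simulation_verification" and w: "(n + 2) ^ 4 \<le> 2 ^ w"
    and words: "\<forall>a\<in>set x. words w a"
  obtain T L R where x: "x = [rel_bits n T, map L [0..<n], rel_bits n R]" and correct: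
    "correct \<longleftrightarrow> (\<exists>Y. \<forall>u<n. \<forall>v<n.
      ((u, v) \<notin> R \<longleftrightarrow> L u \<noteq> L v \<or> (\<exists>u'<n. (u, u') \<in> T \<and> \<not> Y v u')) \<and>
      (Y u v \<longleftrightarrow> (\<exists>u'<n. (u, u') \<in> T \<and> (v, u') \<in> R)))" (is "_ \<longleftrightarrow> (\<exists>Y. ?sol Y)")
    by (rule acyclic_simulation_verification_cases[OF A])
  note wb = word_bounds[OF w]
  have x3: "length x = 3" by (simp add: x)
  define c0 where "c0 z i j = arr (initial_store n (x @ [z])) 3 (i * n + j)" for z i j
  define c1 where "c1 z i j = arr (initial_store n (x @ [z])) 3 (n * n + (i * n + j))" for z i j
  define d0 :: "nat \<Rightarrow> nat \<Rightarrow> nat" where "d0 i j =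
    (\<Sum>k<n. of_bool ((i, k) \<in> T \<and> (j, k) \<in> R)) + of_bool False" for i j
  \<comment> \<open>The parameter \<open>c\<close> reflects that this product is formed from the
    certificate itself.\<close>
  define d1 :: "(nat \<Rightarrow> nat \<Rightarrow> nat) \<Rightarrow> nat \<Rightarrow> nat \<Rightarrow> nat" where "d1 c i j =
    (\<Sum>k<n. of_bool ((i, k) \<in> T \<and> c j k = 0)) + of_bool (L i \<noteq> L j)" for c i j
  define V where "V z \<longleftrightarrow> (\<forall>i<n. \<forall>j<n. (c1 z i j \<noteq> 0 \<longleftrightarrow> (i, j) \<notin> R) \<and>
    c1 z i j = d1 (c0 z) i j \<and> c0 z i j = d0 i j)" for z
  have d0: "d0 i j \<noteq> 0 \<longleftrightarrow> (\<exists>k<n. (i, k) \<in> T \<and> (j, k) \<in> R)" for i j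
    by (auto simp: d0_def)
  have d1: "d1 c i j \<noteq> 0 \<longleftrightarrow> L i \<noteq> L j \<or> (\<exists>k<n. (i, k) \<in> T \<and> c j k = 0)" for c i j
    by (auto simp: d1_def)
  have d1_cong: "d1 c i j = d1 c' i j" if "j < n" "\<And>k. k < n \<Longrightarrow> c j k = c' j k" for c c' i j
    using that by (simp add: d1_def)
  have "d0 i j < 2 ^ w" "d1 c i j < 2 ^ w" for c i j
    using sum_of_bool_le wb(3) unfolding d0_def d1_def by (meson le_less_trans)+
  then have "(\<exists>z. length z \<le> 2 * n * n \<and> words w z \<and>
      (\<forall>i<n. \<forall>j<n. (c1 z i j \<noteq> 0 \<longleftrightarrow> (i, j) \<notin> R) \<and> c0 z i j = d0 i j \<and> c1 z i j = d1 d0 i j)) \<longleftrightarrow>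
      (\<forall>i<n. \<forall>j<n. d1 d0 i j \<noteq> 0 \<longleftrightarrow> (i, j) \<notin> R)"
    using exists_certificate_iff[of n d0 w "d1 d0" "\<lambda>i j a b. b \<noteq> 0 \<longleftrightarrow> (i, j) \<notin> R" x]
    by (simp add: c0_def c1_def x3)
  \<comment> \<open>Once the first half is pinned to \<open>d0\<close> on indices below
    \<open>n\<close>, the second is pinned to \<open>d1 d0\<close>, so the dependence between the
    queries resolves.\<close>
  moreover have "V z \<longleftrightarrow>
      (\<forall>i<n. \<forall>j<n. (c1 z i j \<noteq> 0 \<longleftrightarrow> (i, j) \<notin> R) \<and> c0 z i j = d0 i j \<and> c1 z i j = d1 d0 i j)" for z
    unfolding V_def using d1_cong[of _ "c0 z" d0] by metis
  moreover have "correct \<longleftrightarrow> (\<forall>i<n. \<forall>j<n. d1 d0 i j \<noteq> 0 \<longleftrightarrow> (i, j) \<notin> R)"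
  proof
    assume correct
    then obtain Y where Y: "?sol Y" unfolding correct ..
    \<comment> \<open>The second equation leaves no freedom: every solution \<open>Y\<close> is the
      non-zero pattern of \<open>d0\<close>.\<close>
    have Y_iff: "d0 u v = 0 \<longleftrightarrow> \<not> Y u v" if "u < n" "v < n" for u v
      using Y d0[of u v] that by blast
    have "d1 d0 u v \<noteq> 0 \<longleftrightarrow> (u, v) \<notin> R" if uv: "u < n" "v < n" for u v
    proof -
      have "d1 d0 u v \<noteq> 0 \<longleftrightarrow> L u \<noteq> L v \<or> (\<exists>k<n. (u, k) \<in> T \<and> \<not> Y v k)"
        unfolding d1 using Y_iff[OF uv(2)] by blast
      also have "\<dots> \<longleftrightarrow> (u, v) \<notin> R" using Y uv by blast
      finally show ?thesis .
    qed
    then show "\<forall>i<n. \<forall>j<n. d1 d0 i j \<noteq> 0 \<longleftrightarrow> (i, j) \<notin> R" by blast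
  next
    assume *: "\<forall>i<n. \<forall>j<n. d1 d0 i j \<noteq> 0 \<longleftrightarrow> (i, j) \<notin> R"
    have "?sol (\<lambda>u v. d0 u v \<noteq> 0)"
    proof (intro allI impI conjI)
      fix u v assume "u < n" "v < n"
      then show "(u, v) \<notin> R \<longleftrightarrow> L u \<noteq> L v \<or> (\<exists>u'<n. (u, u') \<in> T \<and> \<not> d0 v u' \<noteq> 0)"
        using * d1[of d0 u v] by simp
      show "d0 u v \<noteq> 0 \<longleftrightarrow> (\<exists>u'<n. (u, u') \<in> T \<and> (v, u') \<in> R)" by (rule d0)
    qed
    then show correct unfolding correct by (rule exI[of ?sol])
  qed
  ultimately have correct_iff: "correct \<longleftrightarrow> (\<exists>z. length z \<le> 2 * n * n \<and> words w z \<and> V z)"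
    by simp
  have "decides_within int_mpv w (matrix_check ?es ?ef) n (x @ [z]) (check_time ?es ?ef n) 2 (2 * n) ans
      \<longleftrightarrow> (ans \<longleftrightarrow> V z)" if z: "words w z" for z ans
  proof -
    have len: "length (x @ [z]) \<le> 9" by (simp add: x)
    have words': "\<forall>a\<in>set (x @ [z]). words w a" using words z by simp
    have T: "holds w n (x @ [z]) (entry 0) (\<lambda>i j. (i, j) \<in> T)"
      by (rule holds_rel_bits[OF wb(1,2)]; simp add: x)
    have R: "holds w n (x @ [z]) (entry 2) (\<lambda>i j. (i, j) \<in> R)"
      by (rule holds_rel_bits[OF wb(1,2)]; simp add: x)
    have L: "holds w n (x @ [z]) label_differs (\<lambda>i j. L i \<noteq> L j)"
      by (rule holds_label_differs[OF wb(1,2)]; simp add: x)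
    have "(3::nat) < 9" by simp
    note c = denotes_words[OF wb(1,2) this words']
    note chk = holds_eq[OF wb(1,2) holds_pos[OF wb(1,2) c(2)] holds_neg_bit[OF wb(1,2) R],
        unfolded of_bool_eq_iff]
    show ?thesis
      unfolding decides_equation_prog(2)[OF w len T holds_neg[OF wb(1,2) c(1)] L c(2)
          T R holds_False[OF wb(1,2)] c(1) chk] V_def d0_def d1_def c0_def c1_def
      by (rule refl)
  qed
  with correct_iff show "\<exists>V. (\<forall>z ans. words w z \<longrightarrow> (decides_within int_mpv w
      (matrix_check ?es ?ef) n (x @ [z]) (check_time ?es ?ef n) 2 (2 * n) ans \<longleftrightarrow> (ans \<longleftrightarrow> V z))) \<and>
    (correct \<longleftrightarrow> (\<exists>z. length z \<le> 2 * n * n \<and> words w z \<and> V z))"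
    by blast
qed

theorem theorem13:
  shows "verifiable_via bool_mpv semi_acyclic_trg_verification \<and>
    certifiable_via int_mpv acyclic_simulation_verification \<and>
    certifiable_via int_mpv semi_acyclic_trg_verification"
  using trg_verifiable simulation_certifiable trg_certifiable by blast

end
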